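(* Let $n\ge 3$ be an integer, $K$ a field, and $T=K[x_1,\ldots,x_n,y_1,\ldots,y_n]$, with indices of the $x$- and $y$-variables taken modulo $n$ (so $x_0=x_n$, $y_0=y_n$). Let $$f_j=x_{j-2}y_j-x_jy_{j+1}\quad (j=1,\ldots,n-1),$$ $$g_k=x_{2k-2}\prod_{\substack{i\in[0,2k)\\ i\text{ odd}}}y_i-x_{n-2}\prod_{\substack{i\in[0,2k)\\ i\text{ even}}}y_i\quad (k=1,\ldots,\lfloor n/2\rfloor),$$ and let $L$ be the defining ideal of the symmetric algebra of $I_{n-2}(C_n)$. Then $\{f_1,\ldots,f_{n-1},g_1,\ldots,g_{\lfloor n/2\rfloor}\}$ is a Gröbner basis of $L$ with respect to any monomial order $<$ on $T$ which is the product order of $<_1$ and $<_2$, where $<_1$ is the reverse lexicographic order on $K[y_1,\ldots,y_n]$ induced by $y_1>y_2>\cdots>y_{n-1}>y_0$, and $<_2$ is an arbitrary monomial order on $K[x_1,\ldots,x_n]$.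
   Context: Let $S=K[x_1,\ldots,x_n]$. $I_{n-2}(C_n)\subset S$ is the $(n-2)$-path ideal of the $n$-cycle, generated by the monomials $u_j=x_jx_{j+1}\cdots x_{j+n-3}$, $j=1,\ldots,n$ (indices modulo $n$). The defining ideal $L\subset T=S[y_1,\ldots,y_n]$ of the symmetric algebra of $I_{n-2}(C_n)$ is the ideal generated by all $\sum_i a_iy_i$ with $a_i\in S$ and $\sum_i a_iu_i=0$; it is known (Brumatti–da Silva) that $L=(f_1,\ldots,f_{n-1},g_1)$. Integer intervals $[0,2k)$ are ordinary intervals (not modulo $n$). The reverse lexicographic order is the usual graded one: monomials are compared first by degree, ties broken reverse lexicographically. The product order of $<_1$ and $<_2$ compares the $y$-parts first: for monomials $u,u'$ in the $x$'s and $v,v'$ in the $y$'s, $uv<u'v'$ iff $v<_1v'$, or $v=v'$ and $u<_2u'$. *)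

theory Defs
  imports "HOL-Library.Poly_Mapping" "HOL-Algebra.Algebraic_Closure_Type"
begin

datatype var = XVar nat | YVar nat

text \<open>A monomial is the finitely supported function of its exponents, so that \<open>0\<close> is the monomial
  \<open>1\<close> and \<open>+\<close> is multiplication of monomials. The index \<open>i\<close> of a variable modulo \<open>n\<close> is represented
  by its residue in \<open>{0..<n}\<close>.\<close>

type_synonym monomial = "var \<Rightarrow>\<^sub>0 nat"
type_synonym 'k mpoly = "monomial \<Rightarrow>\<^sub>0 'k"

definition xvars :: "nat \<Rightarrow> var set"
  where "xvars n = XVar ` {0..<n}"

definition yvars :: "nat \<Rightarrow> var set"
  where "yvars n = YVar ` {0..<n}"

definition varx :: "nat \<Rightarrow> int \<Rightarrow> 'k::field mpoly"
  where "varx n i = Poly_Mapping.single (Poly_Mapping.single (XVar (nat (i mod int n))) 1) 1"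

definition vary :: "nat \<Rightarrow> int \<Rightarrow> 'k::field mpoly"
  where "vary n i = Poly_Mapping.single (Poly_Mapping.single (YVar (nat (i mod int n))) 1) 1"

definition monomials :: "var set \<Rightarrow> monomial set"
  where "monomials V = {m. Poly_Mapping.keys m \<subseteq> V}"

text \<open>The polynomial ring \<open>K[V]\<close> for a set \<open>V\<close> of variables.\<close>

definition poly_ring :: "var set \<Rightarrow> 'k::field mpoly ring"
  where "poly_ring V =
    ring_of_type_algebra\<lparr>carrier := {p. Poly_Mapping.keys p \<subseteq> monomials V}\<rparr>"

lemma monomials_add: "u \<in> monomials V \<Longrightarrow> v \<in> monomials V \<Longrightarrow> u + v \<in> monomials V"
  unfolding monomials_def using Poly_Mapping.keys_add[of u v] by blast

lemma cring_poly_ring: "cring (poly_ring V :: 'k::field mpoly ring)"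
proof -
  let ?C = "{p :: 'k mpoly. Poly_Mapping.keys p \<subseteq> monomials V}"
  have zero: "0 \<in> ?C" and one: "1 \<in> ?C"
    by (simp_all add: monomials_def)
  have uminus: "- p \<in> ?C" if "p \<in> ?C" for p
    using that by simp
  have add: "p + q \<in> ?C" if "p \<in> ?C" "q \<in> ?C" for p q
    using that Poly_Mapping.keys_add[of p q] by blast
  have mult: "p * q \<in> ?C" if "p \<in> ?C" "q \<in> ?C" for p q
    using that keys_mult[of p q] monomials_add by blast
  have neg: "\<exists>q\<in>?C. q + p = 0 \<and> p + q = 0" if "p \<in> ?C" for p
    using uminus[OF that] by (intro bexI[of _ "- p"]) simp_all
  show ?thesis
    unfolding poly_ring_def ring_of_type_algebra_def
    by (unfold_locales; (use zero one in \<open>simp; fail\<close>)?)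
       (insert add mult neg, auto simp: algebra_simps Units_def)
qed


text \<open>Monomial orders are given by their strict part.\<close>

definition monomial_order :: "var set \<Rightarrow> (monomial \<Rightarrow> monomial \<Rightarrow> bool) \<Rightarrow> bool"
  where "monomial_order V lt \<longleftrightarrow>
    irreflp_on (monomials V) lt \<and> transp_on (monomials V) lt \<and> totalp_on (monomials V) lt \<and>
    (\<forall>u\<in>monomials V. u \<noteq> 0 \<longrightarrow> lt 0 u) \<and>
    (\<forall>u\<in>monomials V. \<forall>v\<in>monomials V. \<forall>w\<in>monomials V. lt u v \<longrightarrow> lt (u + w) (v + w))"

definition mon_degree :: "monomial \<Rightarrow> nat"
  where "mon_degree u = (\<Sum>v\<in>Poly_Mapping.keys u. Poly_Mapping.lookup u v)"

text \<open>The graded reverse lexicographic order on the monomials in the variables \<open>vs\<close>, which are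
  listed in decreasing order: in equal degree, the smaller monomial is the one with the larger
  exponent at the last position of \<open>vs\<close> where the exponents differ.\<close>

definition revlex :: "var list \<Rightarrow> monomial \<Rightarrow> monomial \<Rightarrow> bool"
  where "revlex vs u v \<longleftrightarrow>
    mon_degree u < mon_degree v \<or>
    mon_degree u = mon_degree v \<and>
      (\<exists>i<length vs. Poly_Mapping.lookup u (vs ! i) > Poly_Mapping.lookup v (vs ! i) \<and>
        (\<forall>j. i < j \<and> j < length vs \<longrightarrow>
          Poly_Mapping.lookup u (vs ! j) = Poly_Mapping.lookup v (vs ! j)))"

text \<open>\<open>lt\<close> is the product of \<open>lt1\<close> (on the monomials in \<open>V\<^sub>1\<close>, compared first) and \<open>lt2\<close>
  (on the monomials in \<open>V\<^sub>2\<close>).\<close>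

definition is_product_order ::
  "var set \<Rightarrow> var set \<Rightarrow> (monomial \<Rightarrow> monomial \<Rightarrow> bool) \<Rightarrow> (monomial \<Rightarrow> monomial \<Rightarrow> bool) \<Rightarrow>
    (monomial \<Rightarrow> monomial \<Rightarrow> bool) \<Rightarrow> bool"
  where "is_product_order V\<^sub>1 V\<^sub>2 lt1 lt2 lt \<longleftrightarrow>
    (\<forall>v\<in>monomials V\<^sub>1. \<forall>v'\<in>monomials V\<^sub>1. \<forall>u\<in>monomials V\<^sub>2. \<forall>u'\<in>monomials V\<^sub>2.
      lt (u + v) (u' + v') \<longleftrightarrow> lt1 v v' \<or> v = v' \<and> lt2 u u')"

definition initial_monomial ::
  "(monomial \<Rightarrow> monomial \<Rightarrow> bool) \<Rightarrow> 'k::field mpoly \<Rightarrow> monomial"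
  where "initial_monomial lt p =
    (THE m. m \<in> Poly_Mapping.keys p \<and> (\<forall>m'\<in>Poly_Mapping.keys p. m' \<noteq> m \<longrightarrow> lt m' m))"

definition initial_ideal ::
  "var set \<Rightarrow> (monomial \<Rightarrow> monomial \<Rightarrow> bool) \<Rightarrow> 'k::field mpoly set \<Rightarrow> 'k mpoly set"
  where "initial_ideal V lt F =
    Idl\<^bsub>poly_ring V\<^esub> {Poly_Mapping.single (initial_monomial lt p) 1 | p. p \<in> F \<and> p \<noteq> 0}"

definition is_groebner_basis ::
  "var set \<Rightarrow> (monomial \<Rightarrow> monomial \<Rightarrow> bool) \<Rightarrow> 'k::field mpoly set \<Rightarrow> 'k mpoly set \<Rightarrow> bool"
  where "is_groebner_basis V lt G I \<longleftrightarrow>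
    finite G \<and> G \<subseteq> I \<and> 0 \<notin> G \<and> initial_ideal V lt G = initial_ideal V lt I"


text \<open>The generators \<open>u\<^sub>1, \<dots>, u\<^sub>n\<close> of the \<open>(n-2)\<close>-path ideal of the \<open>n\<close>-cycle.\<close>

definition path_gen :: "nat \<Rightarrow> nat \<Rightarrow> 'k::field mpoly"
  where "path_gen n j = (\<Prod>t<n - 2. varx n (int j + int t))"

text \<open>The defining ideal of the symmetric algebra of the ideal \<open>(u\<^sub>1, \<dots>, u\<^sub>n)\<close> of
  \<open>S = K[x\<^sub>1, \<dots>, x\<^sub>n]\<close>, an ideal of \<open>T = S[y\<^sub>1, \<dots>, y\<^sub>n]\<close>.\<close>

definition sym_ideal :: "nat \<Rightarrow> (nat \<Rightarrow> 'k::field mpoly) \<Rightarrow> 'k mpoly set"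
  where "sym_ideal n u =
    Idl\<^bsub>poly_ring (xvars n \<union> yvars n)\<^esub>
      {\<Sum>i=1..n. a i * vary n (int i) | a.
        (\<forall>i\<in>{1..n}. a i \<in> carrier (poly_ring (xvars n))) \<and> (\<Sum>i=1..n. a i * u i) = 0}"

definition f_gen :: "nat \<Rightarrow> nat \<Rightarrow> 'k::field mpoly"
  where "f_gen n j = varx n (int j - 2) * vary n (int j) - varx n (int j) * vary n (int j + 1)"

definition g_gen :: "nat \<Rightarrow> nat \<Rightarrow> 'k::field mpoly"
  where "g_gen n k =
    varx n (2 * int k - 2) * (\<Prod>i | i \<in> {0..<2 * k} \<and> odd i. vary n (int i)) -
    varx n (int n - 2) * (\<Prod>i | i \<in> {0..<2 * k} \<and> even i. vary n (int i))"

end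

theory Submission
  imports Defs
begin

text \<open>
  Let \<open>L\<close> be the defining ideal of the symmetric algebra. Mapping \<open>x_i\<close> to itself and \<open>y_j\<close> to
  \<open>u_j t\<close>, with a new variable \<open>t\<close>, sends every monomial of \<open>T\<close> to a monomial, its weight, and
  sends \<open>T\<close> onto the Rees algebra of the path ideal. This map kills \<open>L\<close>. Moreover every monomial
  of every element of \<open>L\<close> involves some \<open>x_i\<close>, because none of the \<open>u_j\<close> divides another one.

  Call a monomial standard if none of the claimed initial monomials divides it. Suppose that the
  initial monomial \<open>m\<close> of some nonzero \<open>p\<close> in \<open>L\<close> is standard. Since \<open>p\<close> is mapped to \<open>0\<close>, some
  other monomial \<open>m'\<close> of \<open>p\<close> has the same weight as \<open>m\<close>, and \<open>m'\<close> is smaller than \<open>m\<close>. There are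
  only finitely many monomials of this weight, and the least of them is standard: otherwise
  exchanging, in it, the leading term of an \<open>f_j\<close> or \<open>g_k\<close> for the other term would give a smaller
  monomial of the same weight. If a weight has only one standard monomial, then \<open>m\<close> is that least
  monomial, and this contradicts \<open>m' < m\<close>. This argument, for arbitrary binomials and an arbitrary
  weight, is \<open>binomial_groebner_basis\<close>.

  What remains is that two standard monomials of the same weight, one of which involves an \<open>x_i\<close>,
  are equal (\<open>standard_monomial_unique\<close>, by \<open>standard_exponents_eq_of_le\<close>). Let \<open>\<alpha>\<close> and \<open>\<beta>\<close> be
  the differences of their \<open>x\<close>- and \<open>y\<close>-exponents. Equality of weights means that the sum of all
  \<open>\<beta>_j\<close> is \<open>0\<close> and that \<open>\<alpha>_(j-2) = \<beta>_(j-1) + \<beta>_j\<close>. As \<open>x_(j-2) y_j\<close>, the initial monomial of \<open>f_j\<close>,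
  divides neither monomial, a positive \<open>\<alpha>_(j-2)\<close> forces \<open>\<beta>_j \<le> 0\<close>, and a negative one forces
  \<open>\<beta>_j \<ge> 0\<close>. So, along \<open>0, ..., n-1\<close>, the \<open>\<beta>_j\<close> alternate in sign and do not grow in absolute
  value. Their sum being \<open>0\<close>, \<open>\<bar>\<beta>_(2i)\<bar> = \<bar>\<beta>_(2i+1)\<bar>\<close> for all \<open>i\<close>, and \<open>\<beta>_(n-1) = 0\<close> if \<open>n\<close> is odd.
  If \<open>\<beta>\<close> is not \<open>0\<close>, then \<open>\<bar>\<beta>_j\<bar>\<close> either drops for the first time at some \<open>j = 2k\<close>, and then the
  initial monomial \<open>x_(2k-2) y_1 y_3 ... y_(2k-1)\<close> of \<open>g_k\<close> divides one of the two monomials, or it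
  is constant. In the constant case \<open>n\<close> is even and \<open>\<alpha> = 0\<close>, and an \<open>x_i\<close> contained in both monomials
  yields a divisor: the initial monomial of \<open>f_(i+2)\<close>, or that of \<open>g_(n/2)\<close> if \<open>i = n - 2\<close>.
\<close>

section \<open>Ideals of polynomial rings and maps induced by maps of monomials\<close>

lemma poly_ring_simps [simp]:
  "carrier (poly_ring V) = {p. Poly_Mapping.keys p \<subseteq> monomials V}"
  "monoid.mult (poly_ring V) = (*)"
  "one (poly_ring V) = 1"
  "zero (poly_ring V) = 0"
  "add (poly_ring V) = (+)"
  by (simp_all add: poly_ring_def ring_of_type_algebra_def)

lemma ideal_poly_ringI:
  fixes J :: "'k::field mpoly set"
  assumes carrier: "J \<subseteq> carrier (poly_ring V)"
    and zero: "0 \<in> J"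
    and add: "\<And>p q. p \<in> J \<Longrightarrow> q \<in> J \<Longrightarrow> p + q \<in> J"
    and mult: "\<And>r p. r \<in> carrier (poly_ring V) \<Longrightarrow> p \<in> J \<Longrightarrow> r * p \<in> J"
  shows "ideal J (poly_ring V)"
proof -
  interpret R: cring "poly_ring V :: 'k mpoly ring" by (rule cring_poly_ring)
  have minus: "- p \<in> J" if "p \<in> J" for p
    using mult[of "- 1" p] that by (simp add: monomials_def)
  have a_inv: "\<ominus>\<^bsub>poly_ring V\<^esub> p = - p" if "p \<in> J" for p
    using that carrier minus[OF that] by (intro R.minus_equality) auto
  show ?thesis
  proof (rule idealI)
    show "subgroup J (add_monoid (poly_ring V))"
      using carrier zero add minus a_inv
      by (intro R.add.subgroupI) (auto simp flip: a_inv_def)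
    show "p \<otimes>\<^bsub>poly_ring V\<^esub> r \<in> J" if "p \<in> J" "r \<in> carrier (poly_ring V)" for p r
      using mult[OF that(2,1)] by (simp add: mult.commute)
  qed (use mult R.ring_axioms in simp_all)
qed

lemma genideal_poly_ring:
  fixes F :: "'k::field mpoly set"
  assumes "F \<subseteq> carrier (poly_ring V)"
  shows "F \<subseteq> genideal (poly_ring V) F" "ideal (genideal (poly_ring V) F) (poly_ring V)"
    "\<And>J. ideal J (poly_ring V) \<Longrightarrow> F \<subseteq> J \<Longrightarrow> genideal (poly_ring V) F \<subseteq> J"
proof -
  interpret R: cring "poly_ring V :: 'k mpoly ring" by (rule cring_poly_ring)
  show "F \<subseteq> genideal (poly_ring V) F" "ideal (genideal (poly_ring V) F) (poly_ring V)"
    using assms R.genideal_self R.genideal_ideal by blast+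
  show "\<And>J. ideal J (poly_ring V) \<Longrightarrow> F \<subseteq> J \<Longrightarrow> genideal (poly_ring V) F \<subseteq> J"
    by (rule R.genideal_minimal)
qed

lemma ideal_poly_ringD:
  fixes J :: "'k::field mpoly set"
  assumes "ideal J (poly_ring V)"
  shows "\<And>p. p \<in> J \<Longrightarrow> Poly_Mapping.keys p \<subseteq> monomials V"
    "\<And>p q. p \<in> J \<Longrightarrow> q \<in> J \<Longrightarrow> p + q \<in> J"
    "\<And>r p. Poly_Mapping.keys r \<subseteq> monomials V \<Longrightarrow> p \<in> J \<Longrightarrow> r * p \<in> J"
    "0 \<in> J"
proof -
  interpret J: ideal J "poly_ring V" by (rule assms)
  show "\<And>p. p \<in> J \<Longrightarrow> Poly_Mapping.keys p \<subseteq> monomials V" using J.Icarr by simp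
  show "\<And>p q. p \<in> J \<Longrightarrow> q \<in> J \<Longrightarrow> p + q \<in> J"
    using additive_subgroup.a_closed[OF J.additive_subgroup_axioms] by simp
  show "\<And>r p. Poly_Mapping.keys r \<subseteq> monomials V \<Longrightarrow> p \<in> J \<Longrightarrow> r * p \<in> J"
    using J.I_l_closed by simp
  show "0 \<in> J"
    using additive_subgroup.zero_closed[OF J.additive_subgroup_axioms] by simp
qed

text \<open>The linear extension of \<open>w\<close> to polynomials; for additive \<open>w\<close> it is the ring homomorphism that
  \<open>w\<close> induces between the monoid algebras.\<close>

definition pushforward :: "('a \<Rightarrow> 'b) \<Rightarrow> ('a \<Rightarrow>\<^sub>0 'c::comm_monoid_add) \<Rightarrow> 'b \<Rightarrow>\<^sub>0 'c"
  where "pushforward w p =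
    (\<Sum>m\<in>Poly_Mapping.keys p. Poly_Mapping.single (w m) (Poly_Mapping.lookup p m))"

lemma pushforward_superset:
  assumes "finite A" "Poly_Mapping.keys p \<subseteq> A"
  shows "pushforward w p = (\<Sum>m\<in>A. Poly_Mapping.single (w m) (Poly_Mapping.lookup p m))"
  unfolding pushforward_def
  using assms by (intro sum.mono_neutral_left) (auto simp: in_keys_iff)

lemma pushforward_zero [simp]: "pushforward w 0 = 0"
  by (simp add: pushforward_def)

lemma pushforward_single [simp]:
  "pushforward w (Poly_Mapping.single m c) = Poly_Mapping.single (w m) c"
  by (simp add: pushforward_superset[of "{m}"])

lemma pushforward_add: "pushforward w (p + q) = pushforward w p + pushforward w q"
proof -
  let ?A = "Poly_Mapping.keys p \<union> Poly_Mapping.keys q"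
  have *: "pushforward w r = (\<Sum>m\<in>?A. Poly_Mapping.single (w m) (Poly_Mapping.lookup r m))"
    if "Poly_Mapping.keys r \<subseteq> ?A" for r
    using that by (intro pushforward_superset) simp_all
  show ?thesis
    using Poly_Mapping.keys_add[of p q]
    by (simp add: * lookup_add single_add sum.distrib)
qed

lemma pushforward_sum: "pushforward w (\<Sum>i\<in>A. p i) = (\<Sum>i\<in>A. pushforward w (p i))"
  by (induction A rule: infinite_finite_induct) (simp_all add: pushforward_add)

lemma poly_mapping_eq_sum_single:
  "p = (\<Sum>m\<in>Poly_Mapping.keys p. Poly_Mapping.single m (Poly_Mapping.lookup p m))"
  by (rule poly_mapping_eqI)
    (auto simp: lookup_sum lookup_single when_def in_keys_iff)

lemma pushforward_mult:
  fixes p q :: "'a::monoid_add \<Rightarrow>\<^sub>0 'c::semiring_0"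
  assumes "\<And>a b. w (a + b) = w a + (w b :: 'b::monoid_add)"
  shows "pushforward w (p * q) = pushforward w p * pushforward w q"
proof -
  have "p * q = (\<Sum>m\<in>Poly_Mapping.keys p. \<Sum>m'\<in>Poly_Mapping.keys q.
      Poly_Mapping.single (m + m') (Poly_Mapping.lookup p m * Poly_Mapping.lookup q m'))"
    using arg_cong2[OF poly_mapping_eq_sum_single[of p] poly_mapping_eq_sum_single[of q], of "(*)"]
    by (simp only: sum_product mult_single)
  then have "pushforward w (p * q) = (\<Sum>m\<in>Poly_Mapping.keys p. \<Sum>m'\<in>Poly_Mapping.keys q.
      Poly_Mapping.single (w m + w m') (Poly_Mapping.lookup p m * Poly_Mapping.lookup q m'))"
    by (simp add: pushforward_sum assms)
  then show ?thesis
    by (simp add: pushforward_def sum_product mult_single)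
qed

lemma pushforward_ident:
  assumes "\<And>m. m \<in> Poly_Mapping.keys p \<Longrightarrow> w m = m"
  shows "pushforward w p = p"
  unfolding pushforward_def
  by (rule trans[OF sum.cong poly_mapping_eq_sum_single[symmetric]]) (simp_all add: assms)

text \<open>A monomial that is alone in its fibre cannot cancel.\<close>

lemma pushforward_eq_0_collision:
  assumes "pushforward w p = 0" "m \<in> Poly_Mapping.keys p"
  shows "\<exists>m'\<in>Poly_Mapping.keys p. m' \<noteq> m \<and> w m' = w m"
proof (rule ccontr)
  assume "\<not> ?thesis"
  then have *: "w m' = w m \<longleftrightarrow> m' = m" if "m' \<in> Poly_Mapping.keys p" for m'
    using that by blast
  have "Poly_Mapping.lookup (pushforward w p) (w m) =
      (\<Sum>m'\<in>Poly_Mapping.keys p. if m' = m then Poly_Mapping.lookup p m' else 0)"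
    unfolding pushforward_def lookup_sum
    by (intro sum.cong) (auto simp: lookup_single when_def *)
  also have "\<dots> = Poly_Mapping.lookup p m" using assms(2) by simp
  finally show False using assms by (simp add: in_keys_iff)
qed

section \<open>Binomial Groebner bases from a weight\<close>

lemma monomial_orderD:
  assumes "monomial_order V lt"
  shows "\<And>a. a \<in> monomials V \<Longrightarrow> \<not> lt a a"
    "\<And>a b c. a \<in> monomials V \<Longrightarrow> b \<in> monomials V \<Longrightarrow> c \<in> monomials V \<Longrightarrow>
      lt a b \<Longrightarrow> lt b c \<Longrightarrow> lt a c"
    "\<And>a b c. a \<in> monomials V \<Longrightarrow> b \<in> monomials V \<Longrightarrow> c \<in> monomials V \<Longrightarrow>
      lt a b \<Longrightarrow> lt (a + c) (b + c)"
  using assms unfolding monomial_order_def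
  by (blast dest: irreflp_onD, meson transp_onD, blast)

text \<open>The definite description in \<^const>\<open>initial_monomial\<close> is justified by totality, which makes the
  finite set of monomials of \<open>p\<close> have a greatest element.\<close>

lemma initial_monomial_greatest:
  fixes p :: "'k::field mpoly"
  assumes "monomial_order V lt" "p \<noteq> 0" "Poly_Mapping.keys p \<subseteq> monomials V"
  shows "initial_monomial lt p \<in> Poly_Mapping.keys p"
    and "\<And>m. m \<in> Poly_Mapping.keys p \<Longrightarrow> m \<noteq> initial_monomial lt p \<Longrightarrow> lt m (initial_monomial lt p)"
proof -
  let ?K = "Poly_Mapping.keys p"
  let ?P = "\<lambda>m. m \<in> ?K \<and> (\<forall>m'\<in>?K. m' \<noteq> m \<longrightarrow> lt m' m)"
  have tr: "transp_on ?K lt" and irr: "irreflp_on ?K lt" and tot: "totalp_on ?K lt"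
    using assms(1) unfolding monomial_order_def
    by (auto intro: transp_on_subset[OF _ assms(3)] irreflp_on_subset[OF _ assms(3)]
      totalp_on_subset[OF _ assms(3)])
  have as: "asymp_on ?K lt"
    using tr irr by (simp add: asymp_on_iff_irreflp_on_if_transp_on)
  obtain g where g: "?P g"
    using Finite_Set.bex_greatest_element[OF finite_keys _ tr tot] assms(2)
    by auto
  have "?P (initial_monomial lt p)"
    unfolding initial_monomial_def
  proof (rule theI[of ?P g, OF g])
    fix m assume "?P m"
    then show "m = g" using g asymp_onD[OF as, of m g] by metis
  qed
  then show "initial_monomial lt p \<in> ?K"
    and "\<And>m. m \<in> ?K \<Longrightarrow> m \<noteq> initial_monomial lt p \<Longrightarrow> lt m (initial_monomial lt p)"
    by blast+
qed

lemma initial_monomial_binomial: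
  fixes c :: "'k::field"
  assumes "monomial_order V lt" "u \<in> monomials V" "v \<in> monomials V" "lt v u"
  shows "initial_monomial lt (Poly_Mapping.single u 1 - Poly_Mapping.single v (1::'k)) = u"
    and "Poly_Mapping.single u 1 - Poly_Mapping.single v (1::'k) \<noteq> 0"
    and "Poly_Mapping.keys (Poly_Mapping.single u 1 - Poly_Mapping.single v (1::'k)) = {u, v}"
proof -
  let ?p = "Poly_Mapping.single u 1 - Poly_Mapping.single v (1::'k)"
  have ne: "u \<noteq> v" and as: "\<not> lt u v"
    using monomial_orderD[OF assms(1)] assms(2-4) by blast+
  show k: "Poly_Mapping.keys ?p = {u, v}"
    using ne by (auto simp: in_keys_iff lookup_minus lookup_single when_def split: if_splits)
  then show nz: "?p \<noteq> 0" by auto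
  show "initial_monomial lt ?p = u"
  proof (rule ccontr)
    assume *: "initial_monomial lt ?p \<noteq> u"
    have sub: "Poly_Mapping.keys ?p \<subseteq> monomials V" using assms(2,3) k by simp
    note greatest = initial_monomial_greatest[OF assms(1) nz sub]
    have "initial_monomial lt ?p = v" using greatest(1) * k by auto
    moreover have "lt u (initial_monomial lt ?p)" using greatest(2)[of u] * k by auto
    ultimately show False using as by simp
  qed
qed

definition standard :: "monomial set \<Rightarrow> monomial \<Rightarrow> bool"
  where "standard U m \<longleftrightarrow> (\<forall>u\<in>U. \<forall>r. m \<noteq> u + r)"

text \<open>A pair \<open>(u, v)\<close> in \<open>B\<close> stands for the binomial \<open>u - v\<close> with initial monomial \<open>u\<close>. An initial
  monomial of \<open>I\<close> cannot be standard: by cancellation under \<open>w\<close> it shares its fibre with a smaller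
  monomial, while the least monomial of the fibre is standard too, and so would coincide with it.
  The least monomial exists because the fibres are finite. The uniqueness assumption is
  restricted to monomials that occur in elements of \<open>I\<close>, because monomials in the \<open>y\<close>-variables
  alone do not satisfy it in the application when \<open>n\<close> is even.\<close>

lemma binomial_groebner_basis:
  fixes G I :: "'k::field mpoly set" and w :: "monomial \<Rightarrow> monomial"
    and B :: "(monomial \<times> monomial) set"
  assumes order: "monomial_order V lt"
    and B: "finite B" "\<And>u v. (u, v) \<in> B \<Longrightarrow> u \<in> monomials V \<and> v \<in> monomials V \<and> lt v u"
    and G: "G = (\<lambda>(u, v). Poly_Mapping.single u 1 - Poly_Mapping.single v 1) ` B"
    and I: "ideal I (poly_ring V)" "G \<subseteq> I"
    and w_add: "\<And>a b. w (a + b) = w a + w b"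
    and ker: "\<And>p. p \<in> I \<Longrightarrow> pushforward w p = 0"
    and fib: "\<And>m. finite {m' \<in> monomials V. w m' = w m}"
    and unique: "\<And>p m m'. p \<in> I \<Longrightarrow> m \<in> Poly_Mapping.keys p \<Longrightarrow> m' \<in> monomials V \<Longrightarrow> w m' = w m \<Longrightarrow>
      standard (fst ` B) m \<Longrightarrow> standard (fst ` B) m' \<Longrightarrow> m' = m"
  shows "is_groebner_basis V lt G I"
proof -
  let ?in = "\<lambda>F. {Poly_Mapping.single (initial_monomial lt p) (1::'k) | p. p \<in> F \<and> p \<noteq> 0}"
  let ?bin = "\<lambda>u v. Poly_Mapping.single u 1 - Poly_Mapping.single v (1::'k)"
  note ID = ideal_poly_ringD[OF I(1)]
  note irrefl = monomial_orderD(1)[OF order] and trans = monomial_orderD(2)[OF order]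
    and shift = monomial_orderD(3)[OF order]
  have inG: "Poly_Mapping.single u 1 \<in> ?in G" if "(u, v) \<in> B" for u v
  proof -
    have "?bin u v \<in> G" using that by (auto simp: G)
    then show ?thesis
      using initial_monomial_binomial[OF order, of u v] B(2)[OF that] by force
  qed
  have inI_carrier: "?in I \<subseteq> carrier (poly_ring V)"
    using initial_monomial_greatest(1)[OF order] ID(1) by fastforce
  have inG_inI: "?in G \<subseteq> ?in I" using I(2) by blast
  then have inG_carrier: "?in G \<subseteq> carrier (poly_ring V)" using inI_carrier by (rule order_trans)
  have divides: "\<exists>u v r. (u, v) \<in> B \<and> initial_monomial lt p = u + r" if p: "p \<in> I" "p \<noteq> 0" for p
  proof (rule ccontr)
    let ?m = "initial_monomial lt p"
    assume "\<not> ?thesis"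
    then have std: "standard (fst ` B) ?m" by (fastforce simp: standard_def)
    note m = initial_monomial_greatest[OF order p(2) ID(1)[OF p(1)]]
    have mV: "?m \<in> monomials V" using m(1) ID(1)[OF p(1)] by blast
    let ?C = "{m' \<in> monomials V. w m' = w ?m}"
    obtain m1 where m1: "m1 \<in> Poly_Mapping.keys p" "m1 \<noteq> ?m" "w m1 = w ?m"
      using pushforward_eq_0_collision[OF ker[OF p(1)] m(1)] by blast
    have m1V: "m1 \<in> monomials V" using m1(1) ID(1)[OF p(1)] by blast
    have tr: "transp_on ?C lt" and irr: "irreflp_on ?C lt" and tot: "totalp_on ?C lt"
      using order unfolding monomial_order_def
      by (auto intro: transp_on_subset[of "monomials V"] irreflp_on_subset[of "monomials V"]
          totalp_on_subset[of "monomials V"])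
    have as: "asymp_on ?C lt"
      using tr irr by (simp add: asymp_on_iff_irreflp_on_if_transp_on)
    obtain m0 where m0: "m0 \<in> ?C" "\<And>x. x \<in> ?C \<Longrightarrow> x \<noteq> m0 \<Longrightarrow> lt m0 x"
      using Finite_Set.bex_least_element[of ?C lt] fib[of ?m] tr tot as mV by blast
    have "m0 \<noteq> u + r" if uv: "(u, v) \<in> B" for u v r
    proof
      assume eq: "m0 = u + r"
      have rV: "r \<in> monomials V"
      proof -
        have "Poly_Mapping.keys r \<subseteq> Poly_Mapping.keys m0"
          by (auto simp: eq in_keys_iff lookup_add)
        then show ?thesis using m0(1) by (auto simp: monomials_def)
      qed
      \<comment> \<open>The exchange of \<open>u\<close> for \<open>v\<close> stays in the fibre because \<open>u - v\<close> lies in the kernel.\<close>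
      have "?bin u v \<in> I" using uv I(2) by (auto simp: G)
      from ker[OF this] have "w u = w v"
        by (metis (no_types, lifting) diff_add_cancel add_0 pushforward_add pushforward_single
            lookup_single_eq lookup_single_not_eq zero_neq_one)
      then have C: "v + r \<in> ?C"
        using m0(1) monomials_add[of v V r] B(2)[OF uv] rV by (auto simp: eq w_add)
      have less: "lt (v + r) m0"
        unfolding eq using shift B(2)[OF uv] rV by blast
      show False
      proof (cases "v + r = m0")
        case True
        then show False using less irrefl[of m0] m0(1) by simp
      next
        case False
        then have "lt m0 (v + r)" using m0(2)[OF C] by blast
        then show False using less irrefl[of m0] trans[of m0 "v + r" m0] m0(1) C by blast
      qed
    qed
    then have "standard (fst ` B) m0" unfolding standard_def by fastforce
    then have "m0 = ?m"
      using unique[OF p(1) m(1), of m0] m0(1) std by blast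
    then have "lt ?m m1" using m0(2)[of m1] m1 m1V by blast
    moreover have "lt m1 ?m" using m(2) m1 by blast
    ultimately show False using trans irrefl mV m1V by blast
  qed
  have "?in I \<subseteq> genideal (poly_ring V) (?in G)"
  proof
    fix q assume "q \<in> ?in I"
    then obtain p where p: "p \<in> I" "p \<noteq> 0" and q: "q = Poly_Mapping.single (initial_monomial lt p) 1"
      by blast
    obtain u v r where uv: "(u, v) \<in> B" and eq: "initial_monomial lt p = u + r"
      using divides[OF p] by blast
    have "u + r \<in> monomials V"
      using initial_monomial_greatest(1)[OF order p(2)] ID(1)[OF p(1)] eq by auto
    then have "r \<in> monomials V"
      unfolding monomials_def by (auto simp: in_keys_iff lookup_add subset_iff)
    then have "Poly_Mapping.keys (Poly_Mapping.single r (1::'k)) \<subseteq> monomials V" by simp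
    moreover have "q = Poly_Mapping.single r 1 * Poly_Mapping.single u 1"
      by (simp add: q eq mult_single add.commute)
    ultimately show "q \<in> genideal (poly_ring V) (?in G)"
      using genideal_poly_ring(1)[OF inG_carrier] inG[OF uv]
        ideal_poly_ringD(3)[OF genideal_poly_ring(2)[OF inG_carrier]] by blast
  qed
  then have "genideal (poly_ring V) (?in I) \<subseteq> genideal (poly_ring V) (?in G)"
    by (intro genideal_poly_ring(3) genideal_poly_ring(2) inI_carrier inG_carrier)
  moreover have "genideal (poly_ring V) (?in G) \<subseteq> genideal (poly_ring V) (?in I)"
    using genideal_poly_ring(3)[OF inG_carrier genideal_poly_ring(2)[OF inI_carrier]]
      genideal_poly_ring(1)[OF inI_carrier] inG_inI by blast
  moreover have "0 \<notin> G"
    using initial_monomial_binomial(2)[OF order] B(2) by (fastforce simp: G)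
  ultimately show ?thesis
    using B(1) I(2) unfolding is_groebner_basis_def initial_ideal_def by (auto simp: G)
qed

section \<open>The weight of a monomial in the Rees algebra of the path ideal\<close>

definition xmon :: "nat \<Rightarrow> monomial"
  where "xmon i = Poly_Mapping.single (XVar i) 1"

definition ymon :: "nat \<Rightarrow> monomial"
  where "ymon i = Poly_Mapping.single (YVar i) 1"

lemma lookup_xmon [simp]:
  "Poly_Mapping.lookup (xmon i) (XVar j) = (if i = j then 1 else 0)"
  "Poly_Mapping.lookup (xmon i) (YVar j) = 0"
  by (simp_all add: xmon_def lookup_single when_def)

lemma lookup_ymon [simp]:
  "Poly_Mapping.lookup (ymon i) (YVar j) = (if i = j then 1 else 0)"
  "Poly_Mapping.lookup (ymon i) (XVar j) = 0"
  by (simp_all add: ymon_def lookup_single when_def)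

lemma xmon_in_monomials [simp]: "i < n \<Longrightarrow> xmon i \<in> monomials (xvars n)"
  by (simp add: xmon_def monomials_def xvars_def)

lemma ymon_in_monomials [simp]: "i < n \<Longrightarrow> ymon i \<in> monomials (yvars n)"
  by (simp add: ymon_def monomials_def yvars_def)

lemma varx_of_nat: "varx n (int i) = Poly_Mapping.single (xmon (i mod n)) 1"
  by (simp add: varx_def xmon_def nat_mod_as_int)

lemma vary_of_nat: "vary n (int i) = Poly_Mapping.single (ymon (i mod n)) 1"
  by (simp add: vary_def ymon_def nat_mod_as_int)

lemma varx_cong: "i mod int n = j mod int n \<Longrightarrow> varx n i = varx n j"
  by (simp add: varx_def)

lemma vary_cong: "i mod int n = j mod int n \<Longrightarrow> vary n i = vary n j"
  by (simp add: vary_def)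

lemma varx_minus_2:
  assumes "n \<ge> 2"
  shows "varx n (int j - 2) = Poly_Mapping.single (xmon ((j + n - 2) mod n)) 1"
proof -
  have "varx n (int j - 2) = varx n (int (j + n - 2))"
  proof (rule varx_cong)
    have "int (j + n - 2) = int j - 2 + int n" using assms by simp
    then show "(int j - 2) mod int n = int (j + n - 2) mod int n" by (simp only: mod_add_self2)
  qed
  then show ?thesis by (simp only: varx_of_nat)
qed

lemma monomials_mono: "V \<subseteq> W \<Longrightarrow> monomials V \<subseteq> monomials W"
  by (auto simp: monomials_def)

lemma keys_mult_monomials:
  assumes "Poly_Mapping.keys p \<subseteq> monomials V" "Poly_Mapping.keys q \<subseteq> monomials V"
  shows "Poly_Mapping.keys (p * q) \<subseteq> monomials V"
  using keys_mult[of p q] assms monomials_add by blast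

lemma prod_single_one:
  "finite A \<Longrightarrow> (\<Prod>i\<in>A. Poly_Mapping.single (m i) 1) =
    (Poly_Mapping.single (\<Sum>i\<in>A. m i) 1 :: 'a::comm_monoid_add \<Rightarrow>\<^sub>0 'b::comm_semiring_1)"
  by (induction A rule: finite_induct) (simp_all add: mult_single)

lemma add_mod_eq_self_iff: "(j + s) mod n = j mod n \<longleftrightarrow> n dvd s" for j s n :: nat
  using mod_eq_dvd_iff_nat[of j "j + s" n] by simp

lemma add_mod_eq_iff:
  fixes i j n :: nat
  assumes "i < n" "j < n"
  shows "(c + i) mod n = (c + j) mod n \<longleftrightarrow> i = j"
proof -
  have *: "a = b" if "(c + a) mod n = (c + b) mod n" "a \<le> b" "b < n" for a b
  proof -
    have "(c + a + (b - a)) mod n = (c + a) mod n" using that by simp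
    then have "n dvd b - a" by (simp only: add_mod_eq_self_iff)
    then show ?thesis using that(2,3) by (auto dest: dvd_imp_le)
  qed
  show ?thesis
    using *[of i j] *[of j i] assms by (metis nat_le_linear)
qed

text \<open>The exponent vector of \<open>u_j\<close> for a residue \<open>j\<close>: the product of all \<open>x_i\<close> except \<open>x_(j-1)\<close> and
  \<open>x_(j-2)\<close>. Describing \<open>u_j\<close> by what it omits makes weights easy to compare.\<close>

definition path_mon :: "nat \<Rightarrow> nat \<Rightarrow> monomial"
  where "path_mon n j = (\<Sum>i | i < n \<and> (i + 1) mod n \<noteq> j \<and> (i + 2) mod n \<noteq> j. xmon i)"

lemma lookup_path_mon:
  "Poly_Mapping.lookup (path_mon n j) (XVar i) =
    (if i < n \<and> (i + 1) mod n \<noteq> j \<and> (i + 2) mod n \<noteq> j then 1 else 0)"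
  "Poly_Mapping.lookup (path_mon n j) (YVar i) = 0"
  by (simp_all add: path_mon_def lookup_sum lookup_single when_def)

text \<open>The map sending \<open>t\<close> to \<open>j + t\<close> permutes the residues, and \<open>t = n - 1\<close> and \<open>t = n - 2\<close> are
  the only two values whose image is omitted from \<open>u_j\<close>.\<close>

lemma path_gen_eq_single:
  assumes n: "n \<ge> 3"
  shows "path_gen n j = Poly_Mapping.single (path_mon n (j mod n)) (1::'k::field)"
proof -
  let ?f = "\<lambda>t. (j + t) mod n"
  let ?A = "{i. i < n \<and> (i + 1) mod n \<noteq> j mod n \<and> (i + 2) mod n \<noteq> j mod n}"
  have inj: "inj_on ?f {..<n}"
    by (rule inj_onI) (simp add: add_mod_eq_iff)
  have surj: "?f ` {..<n} = {..<n}"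
    by (rule endo_inj_surj) (use inj n in auto)
  have mem: "?f t \<in> ?A \<longleftrightarrow> t < n - 2" if "t < n" for t
  proof -
    have "(?f t + 1) mod n = j mod n \<longleftrightarrow> n dvd t + 1"
      by (metis mod_add_left_eq add.assoc add_mod_eq_self_iff)
    also have "\<dots> \<longleftrightarrow> t + 1 = n"
      using that n by (auto dest: dvd_imp_le)
    finally have 1: "(?f t + 1) mod n = j mod n \<longleftrightarrow> t + 1 = n" .
    have "(?f t + 2) mod n = j mod n \<longleftrightarrow> n dvd t + 2"
      by (metis mod_add_left_eq add.assoc add_mod_eq_self_iff)
    also have "\<dots> \<longleftrightarrow> t + 2 = n"
    proof
      assume dvd: "n dvd t + 2"
      show "t + 2 = n"
      proof (rule ccontr)
        assume "t + 2 \<noteq> n"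
        moreover have "n \<le> t + 2" using dvd by (rule dvd_imp_le) simp
        ultimately have "t + 2 = n + 1" using that by simp
        then have "n dvd 1" using dvd by (metis dvd_add_triv_left_iff)
        then show False using n by simp
      qed
    qed simp
    finally show ?thesis using 1 that n by auto
  qed
  have "?f ` {..<n - 2} = ?A"
  proof
    show "?f ` {..<n - 2} \<subseteq> ?A"
    proof (rule image_subsetI)
      fix t assume "t \<in> {..<n - 2}"
      then have "t < n" "t < n - 2" by simp_all
      then show "?f t \<in> ?A" using mem by blast
    qed
    show "?A \<subseteq> ?f ` {..<n - 2}"
    proof
      fix i assume i: "i \<in> ?A"
      then obtain t where "t < n" "i = ?f t" using surj by (metis (no_types, lifting) imageE lessThan_iff mem_Collect_eq)
      then show "i \<in> ?f ` {..<n - 2}" using mem[of t] i by simp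
    qed
  qed
  moreover have "inj_on ?f {..<n - 2}"
    by (rule inj_on_subset[OF inj]) auto
  ultimately have "(\<Sum>i\<in>?A. xmon i) = (\<Sum>t<n - 2. xmon (?f t))"
    by (intro sum.reindex_bij_betw[symmetric]) (simp add: bij_betw_def)
  moreover have "path_gen n j = (\<Prod>t<n - 2. Poly_Mapping.single (xmon (?f t)) (1::'k))"
    unfolding path_gen_def by (simp flip: of_nat_add add: varx_of_nat)
  ultimately show ?thesis
    by (simp add: prod_single_one path_mon_def)
qed

text \<open>The image of \<open>m\<close> under \<open>x_i \<mapsto> x_i\<close>, \<open>y_j \<mapsto> u_j t\<close>: the exponent of \<open>x_i\<close> counts every
  \<open>y_j\<close> with \<open>j \<noteq> i + 1\<close> and \<open>j \<noteq> i + 2\<close>. The variable \<open>YVar 0\<close> of the target serves as \<open>t\<close>.\<close>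

definition weight :: "nat \<Rightarrow> monomial \<Rightarrow> monomial"
  where "weight n m =
    (\<Sum>i<n. Poly_Mapping.single (XVar i) (Poly_Mapping.lookup m (XVar i) +
      (\<Sum>j\<in>{..<n} - {(i + 1) mod n, (i + 2) mod n}. Poly_Mapping.lookup m (YVar j)))) +
    Poly_Mapping.single (YVar 0) (\<Sum>j<n. Poly_Mapping.lookup m (YVar j))"

lemma lookup_weight:
  "Poly_Mapping.lookup (weight n m) (XVar i) = (if i < n then Poly_Mapping.lookup m (XVar i) +
      (\<Sum>j\<in>{..<n} - {(i + 1) mod n, (i + 2) mod n}. Poly_Mapping.lookup m (YVar j)) else 0)"
  "Poly_Mapping.lookup (weight n m) (YVar i) =
    (if i = 0 then \<Sum>j<n. Poly_Mapping.lookup m (YVar j) else 0)"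
  by (simp_all add: weight_def lookup_add lookup_sum lookup_single when_def)

lemma weight_add: "weight n (a + b) = weight n a + weight n b"
  by (simp add: weight_def lookup_add sum.distrib single_add ac_simps)

lemma lookup_X_of_xvars:
  assumes "m \<in> monomials (xvars n)"
  shows "\<not> i < n \<Longrightarrow> Poly_Mapping.lookup m (XVar i) = 0" "Poly_Mapping.lookup m (YVar i) = 0"
proof -
  have "v \<in> xvars n" if "Poly_Mapping.lookup m v \<noteq> 0" for v
    using that assms by (auto simp: monomials_def in_keys_iff)
  then show "\<not> i < n \<Longrightarrow> Poly_Mapping.lookup m (XVar i) = 0" "Poly_Mapping.lookup m (YVar i) = 0"
    by (force simp: xvars_def)+
qed

lemma poly_mapping_var_eqI:
  assumes "\<And>i. Poly_Mapping.lookup m (XVar i) = Poly_Mapping.lookup m' (XVar i)"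
    and "\<And>i. Poly_Mapping.lookup m (YVar i) = Poly_Mapping.lookup m' (YVar i)"
  shows "m = (m' :: monomial)"
proof (rule poly_mapping_eqI)
  fix v show "Poly_Mapping.lookup m v = Poly_Mapping.lookup m' v"
    using assms by (cases v) simp_all
qed

lemma weight_xvars: "m \<in> monomials (xvars n) \<Longrightarrow> weight n m = m"
  by (rule poly_mapping_var_eqI) (auto simp: lookup_weight lookup_X_of_xvars)

lemma weight_ymon:
  assumes "j < n"
  shows "weight n (ymon j) = path_mon n j + ymon 0"
  using assms
  by (intro poly_mapping_var_eqI)
    (auto simp: lookup_weight lookup_path_mon lookup_add lookup_single when_def)

text \<open>The weight bounds all exponents, those of the \<open>y_j\<close> through the exponent of \<open>t\<close>.\<close>

lemma finite_weight_fibre: "finite {m' \<in> monomials (xvars n \<union> yvars n). weight n m' = c}"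
proof -
  let ?V = "xvars n \<union> yvars n"
  let ?S = "{m' \<in> monomials ?V. weight n m' = c}"
  let ?F = "{f :: var \<Rightarrow> nat. \<forall>v. (v \<in> ?V \<longrightarrow> f v \<in> {..mon_degree c}) \<and> (v \<notin> ?V \<longrightarrow> f v = 0)}"
  have bound: "Poly_Mapping.lookup c v \<le> mon_degree c" for v
    unfolding mon_degree_def
    by (cases "v \<in> Poly_Mapping.keys c") (auto simp: in_keys_iff intro: member_le_sum)
  have "Poly_Mapping.lookup m' \<in> ?F" if "m' \<in> ?S" for m'
  proof (intro CollectI allI conjI impI)
    fix v
    show "Poly_Mapping.lookup m' v = 0" if "v \<notin> ?V"
      using that \<open>m' \<in> ?S\<close> by (auto simp: monomials_def in_keys_iff)
    assume "v \<in> ?V"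
    then consider i where "v = XVar i" "i < n" | i where "v = YVar i" "i < n"
      by (auto simp: xvars_def yvars_def)
    then have "\<exists>v'. Poly_Mapping.lookup m' v \<le> Poly_Mapping.lookup (weight n m') v'"
    proof cases
      case 1
      then have "Poly_Mapping.lookup m' v \<le> Poly_Mapping.lookup (weight n m') v"
        by (simp add: lookup_weight)
      then show ?thesis ..
    next
      case 2
      then have "Poly_Mapping.lookup m' v \<le> Poly_Mapping.lookup (weight n m') (YVar 0)"
        by (auto simp: lookup_weight intro: member_le_sum)
      then show ?thesis ..
    qed
    then show "Poly_Mapping.lookup m' v \<in> {..mon_degree c}"
      using bound that by (auto intro: order_trans)
  qed
  then have "Poly_Mapping.lookup ` ?S \<subseteq> ?F" by (rule image_subsetI)
  moreover have "finite ?F"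
    by (rule finite_set_of_finite_funs) (simp_all add: xvars_def yvars_def)
  ultimately have "finite (Poly_Mapping.lookup ` ?S)" by (rule finite_subset)
  then show ?thesis
    by (rule finite_imageD) (simp add: inj_on_def lookup_inject)
qed

text \<open>Divisibility of \<open>u_j\<close> by \<open>u_j'\<close> means that the two consecutive indices omitted from \<open>u_j\<close>
  are also omitted from \<open>u_j'\<close>. Only one pair of cyclically consecutive residues contains both, as
  \<open>n \<ge> 3\<close>.\<close>

lemma path_mon_dvd_imp_eq:
  assumes n: "n \<ge> 3" and j: "j < n" "j' < n" and eq: "r + path_mon n j' = path_mon n j"
  shows "j' = j" "r = 0"
proof -
  have zero: "(i + 1) mod n = j' \<or> (i + 2) mod n = j'"
    if "i < n" "(i + 1) mod n = j \<or> (i + 2) mod n = j" for i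
    using arg_cong[OF eq, of "\<lambda>m. Poly_Mapping.lookup m (XVar i)"] that
    by (auto simp: lookup_add lookup_path_mon split: if_splits)
  show "j' = j"
  proof (rule ccontr)
    assume ne: "j' \<noteq> j"
    let ?i1 = "(j + (n - 1)) mod n" and ?i2 = "(j + (n - 2)) mod n"
    have i1: "(?i1 + 1) mod n = j" "(?i1 + 2) mod n = (j + 1) mod n"
    proof -
      have "(?i1 + 1) mod n = (j + (n - 1) + 1) mod n" by (rule mod_add_left_eq)
      also have "j + (n - 1) + 1 = j + n" using n by simp
      finally show "(?i1 + 1) mod n = j" using j by simp
      have "(?i1 + 2) mod n = (j + (n - 1) + 2) mod n" by (rule mod_add_left_eq)
      also have "j + (n - 1) + 2 = j + 1 + n" using n by simp
      finally show "(?i1 + 2) mod n = (j + 1) mod n" by (simp only: mod_add_self2)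
    qed
    have i2: "(?i2 + 2) mod n = j"
    proof -
      have "(?i2 + 2) mod n = (j + (n - 2) + 2) mod n" by (rule mod_add_left_eq)
      also have "j + (n - 2) + 2 = j + n" using n by simp
      finally show "(?i2 + 2) mod n = j" using j by simp
    qed
    have j1: "(j + 1) mod n = j'"
      using zero[of ?i1] i1 ne n by auto
    have j2: "(?i2 + 1) mod n = j'"
      using zero[of ?i2] i2 ne n by auto
    have "(j + 2) mod n = (j' + 1) mod n"
      using j1 by (metis mod_add_left_eq add.assoc one_add_one)
    also have "\<dots> = (?i2 + 2) mod n"
      using j2 by (metis mod_add_left_eq add.assoc one_add_one)
    finally have "(j + 2) mod n = j mod n" using i2 j by simp
    then have "n dvd 2" by (simp only: add_mod_eq_self_iff)
    then show False using n by (auto dest: dvd_imp_le)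
  qed
  then show "r = 0" using eq by simp
qed

section \<open>The defining ideal of the symmetric algebra\<close>

text \<open>The generators of \<^const>\<open>sym_ideal\<close>, named so that properties of the ideal can be checked on
  them.\<close>

definition syzygy_forms :: "nat \<Rightarrow> (nat \<Rightarrow> 'k::field mpoly) \<Rightarrow> 'k mpoly set"
  where "syzygy_forms n u = {\<Sum>i=1..n. a i * vary n (int i) | a.
    (\<forall>i\<in>{1..n}. a i \<in> carrier (poly_ring (xvars n))) \<and> (\<Sum>i=1..n. a i * u i) = 0}"

lemma sym_ideal_eq: "sym_ideal n u = genideal (poly_ring (xvars n \<union> yvars n)) (syzygy_forms n u)"
  by (simp add: sym_ideal_def syzygy_forms_def)

lemma keys_syzygy_form:
  fixes a :: "nat \<Rightarrow> 'k::field mpoly"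
  assumes "m \<in> Poly_Mapping.keys (\<Sum>i=1..n. a i * vary n (int i))"
  shows "\<exists>i\<in>{1..n}. \<exists>r\<in>Poly_Mapping.keys (a i). m = r + ymon (i mod n)"
proof -
  obtain i where i: "i \<in> {1..n}" "m \<in> Poly_Mapping.keys (a i * vary n (int i))"
    using assms keys_sum[of "\<lambda>i. a i * vary n (int i)" "{1..n}"] by blast
  then show ?thesis
    using keys_mult[of "a i" "vary n (int i)"] unfolding vary_of_nat by fastforce
qed

lemma syzygy_forms_carrier:
  assumes n: "n \<ge> 1"
  shows "syzygy_forms n u \<subseteq> carrier (poly_ring (xvars n \<union> yvars n))"
proof
  fix p assume "p \<in> syzygy_forms n u"
  then obtain a where a: "\<forall>i\<in>{1..n}. a i \<in> carrier (poly_ring (xvars n))"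
    and p: "p = (\<Sum>i=1..n. a i * vary n (int i))" by (auto simp: syzygy_forms_def)
  have "m \<in> monomials (xvars n \<union> yvars n)" if mp: "m \<in> Poly_Mapping.keys p" for m
  proof -
    obtain i r where ir: "i \<in> {1..n}" "r \<in> Poly_Mapping.keys (a i)" "m = r + ymon (i mod n)"
      using keys_syzygy_form[of m a n] mp p by blast
    have "r \<in> monomials (xvars n \<union> yvars n)"
    proof -
      have "Poly_Mapping.keys (a i) \<subseteq> monomials (xvars n)" using a ir(1) by simp
      then show ?thesis
        using ir(2) monomials_mono[of "xvars n" "xvars n \<union> yvars n"] by blast
    qed
    moreover have "ymon (i mod n) \<in> monomials (xvars n \<union> yvars n)"
      using n ymon_in_monomials[of "i mod n" n] monomials_mono[of "yvars n" "xvars n \<union> yvars n"] by auto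
    ultimately show ?thesis using monomials_add ir(3) by blast
  qed
  then show "p \<in> carrier (poly_ring (xvars n \<union> yvars n))" by auto
qed

text \<open>The image of \<open>\<Sum> a_i y_i\<close> is \<open>t \<Sum> a_i u_i\<close>.\<close>

lemma pushforward_weight_syzygy_form:
  assumes n: "n \<ge> 3" and p: "p \<in> syzygy_forms n (path_gen n)"
  shows "pushforward (weight n) p = 0"
proof -
  obtain a where a: "\<forall>i\<in>{1..n}. a i \<in> carrier (poly_ring (xvars n))"
    and rel: "(\<Sum>i=1..n. a i * path_gen n i) = 0"
    and p: "p = (\<Sum>i=1..n. a i * vary n (int i))" using p by (auto simp: syzygy_forms_def)
  have "pushforward (weight n) (a i * vary n (int i)) =
      a i * path_gen n i * Poly_Mapping.single (ymon 0) 1" if "i \<in> {1..n}" for i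
  proof -
    have "pushforward (weight n) (a i) = a i"
      using a that by (intro pushforward_ident weight_xvars) auto
    then show ?thesis
      using n by (simp add: pushforward_mult weight_add vary_of_nat weight_ymon
        path_gen_eq_single mult_single mult.assoc)
  qed
  then have "pushforward (weight n) p = (\<Sum>i=1..n. a i * path_gen n i) * Poly_Mapping.single (ymon 0) 1"
    by (simp add: p pushforward_sum sum_distrib_right)
  then show ?thesis by (simp only: rel mult_zero_left)
qed

text \<open>Were \<open>y_i\<close> alone a monomial of \<open>p\<close>, it would have to cancel in the Rees algebra against some
  \<open>r' y_i'\<close> with \<open>r' u_i' = u_i\<close>; but then \<open>i' = i\<close> and \<open>r' = 1\<close>.\<close>

lemma keys_syzygy_form_has_x:
  assumes n: "n \<ge> 3" and p: "p \<in> syzygy_forms n (path_gen n)" and m: "m \<in> Poly_Mapping.keys p"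
  shows "\<exists>i<n. Poly_Mapping.lookup m (XVar i) \<noteq> 0"
proof (rule ccontr)
  assume nox: "\<not> ?thesis"
  obtain a where a: "\<forall>i\<in>{1..n}. a i \<in> carrier (poly_ring (xvars n))"
    and pa: "p = (\<Sum>i=1..n. a i * vary n (int i))" using p by (auto simp: syzygy_forms_def)
  obtain i r where ir: "i \<in> {1..n}" "r \<in> Poly_Mapping.keys (a i)" "m = r + ymon (i mod n)"
    using keys_syzygy_form[of m a n] m pa by blast
  have "r \<in> monomials (xvars n)" using a ir by auto
  moreover have "Poly_Mapping.lookup r (XVar j) = 0" if "j < n" for j
    using nox that by (auto simp: ir(3) lookup_add lookup_single)
  ultimately have "r = 0"
    by (intro poly_mapping_var_eqI) (use lookup_X_of_xvars[of r n] in \<open>metis lookup_zero\<close>)+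
  then have my: "m = ymon (i mod n)" using ir(3) by simp
  obtain m' where m': "m' \<in> Poly_Mapping.keys p" "m' \<noteq> m" "weight n m' = weight n m"
    using pushforward_eq_0_collision[OF pushforward_weight_syzygy_form[OF n p] m] by blast
  obtain i' r' where ir': "i' \<in> {1..n}" "r' \<in> Poly_Mapping.keys (a i')" "m' = r' + ymon (i' mod n)"
    using keys_syzygy_form[of m' a n] m'(1) pa by blast
  have "r' \<in> monomials (xvars n)" using a ir' by auto
  then have "r' + path_mon n (i' mod n) = path_mon n (i mod n)"
    using m'(3) n by (simp add: my ir'(3) weight_add weight_xvars weight_ymon flip: add.assoc)
  then have "i' mod n = i mod n" "r' = 0"
    using path_mon_dvd_imp_eq[OF n, of "i mod n" "i' mod n" r'] n by simp_all
  then show False using m'(2) my ir'(3) by simp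
qed

lemma ideal_sym_ideal:
  assumes "n \<ge> 3"
  shows "ideal (sym_ideal n u) (poly_ring (xvars n \<union> yvars n))"
    and "syzygy_forms n u \<subseteq> sym_ideal n u"
  using genideal_poly_ring(1,2)[OF syzygy_forms_carrier[of n u]] assms
  by (simp_all add: sym_ideal_eq)

lemma sym_ideal_subset_kernel:
  assumes n: "n \<ge> 3" and p: "p \<in> sym_ideal n (path_gen n)"
  shows "pushforward (weight n) p = 0"
    and "\<And>m. m \<in> Poly_Mapping.keys p \<Longrightarrow> \<exists>i<n. Poly_Mapping.lookup m (XVar i) \<noteq> 0"
proof -
  let ?R = "poly_ring (xvars n \<union> yvars n) :: 'a mpoly ring"
  let ?J = "{p \<in> carrier ?R. pushforward (weight n) p = 0 \<and>
    (\<forall>m\<in>Poly_Mapping.keys p. \<exists>i<n. Poly_Mapping.lookup m (XVar i) \<noteq> 0)}"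
  have "ideal ?J ?R"
  proof (rule ideal_poly_ringI)
    fix p q assume *: "p \<in> ?J" "q \<in> ?J"
    have sum: "m \<in> Poly_Mapping.keys p \<or> m \<in> Poly_Mapping.keys q"
      if "m \<in> Poly_Mapping.keys (p + q)" for m
      using that Poly_Mapping.keys_add[of p q] by blast
    show "p + q \<in> ?J"
    proof (intro CollectI conjI ballI)
      show "p + q \<in> carrier ?R" using * Poly_Mapping.keys_add[of p q] by simp blast
      show "pushforward (weight n) (p + q) = 0" using * by (simp add: pushforward_add)
      show "\<exists>i<n. Poly_Mapping.lookup m (XVar i) \<noteq> 0" if "m \<in> Poly_Mapping.keys (p + q)" for m
        using sum[OF that] * by blast
    qed
  next
    fix r p assume *: "r \<in> carrier ?R" "p \<in> ?J"
    have "\<exists>i<n. Poly_Mapping.lookup m (XVar i) \<noteq> 0" if m: "m \<in> Poly_Mapping.keys (r * p)" for m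
    proof -
      obtain s t where "m = s + t" "t \<in> Poly_Mapping.keys p"
        using m keys_mult[of r p] by blast
      then show ?thesis using * by (fastforce simp: lookup_add)
    qed
    then show "r * p \<in> ?J"
      using * keys_mult_monomials[of r "xvars n \<union> yvars n" p]
      by (simp add: pushforward_mult weight_add)
  qed auto
  moreover have "syzygy_forms n (path_gen n) \<subseteq> ?J"
    using syzygy_forms_carrier[of n] pushforward_weight_syzygy_form[OF n]
      keys_syzygy_form_has_x[OF n] n by fastforce
  ultimately have "sym_ideal n (path_gen n) \<subseteq> ?J"
    unfolding sym_ideal_eq using n
    by (intro genideal_poly_ring(3) syzygy_forms_carrier) auto
  then have "p \<in> ?J" using p by blast
  then show "pushforward (weight n) p = 0"
    and "\<And>m. m \<in> Poly_Mapping.keys p \<Longrightarrow> \<exists>i<n. Poly_Mapping.lookup m (XVar i) \<noteq> 0"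
    by auto
qed

lemma binary_syzygy_in_sym_ideal:
  fixes u :: "nat \<Rightarrow> 'k::field mpoly"
  assumes n: "n \<ge> 3" and ij: "i \<in> {1..n}" "j \<in> {1..n}" "i \<noteq> j"
    and cd: "Poly_Mapping.keys c \<subseteq> monomials (xvars n)" "Poly_Mapping.keys d \<subseteq> monomials (xvars n)"
    and rel: "c * u i = d * u j"
  shows "c * vary n (int i) - d * vary n (int j) \<in> sym_ideal n u"
proof -
  define a where "a k = (if k = i then c else if k = j then - d else 0)" for k
  have sum: "(\<Sum>k=1..n. a k * h k) = c * h i - d * h j" for h :: "nat \<Rightarrow> 'k mpoly"
  proof -
    have "(\<Sum>k=1..n. a k * h k) = (\<Sum>k=1..n. (if k = i then c * h k else 0) - (if k = j then d * h k else 0))"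
      using ij(3) by (intro sum.cong) (auto simp: a_def)
    also have "\<dots> = c * h i - d * h j"
      using ij by (simp add: sum_subtractf)
    finally show ?thesis .
  qed
  have "\<forall>k\<in>{1..n}. a k \<in> carrier (poly_ring (xvars n))"
    using cd by (simp add: a_def)
  moreover have "(\<Sum>k=1..n. a k * u k) = 0" by (simp only: sum rel diff_self)
  ultimately have "(\<Sum>k=1..n. a k * vary n (int k)) \<in> syzygy_forms n u"
    unfolding syzygy_forms_def by blast
  then show ?thesis using ideal_sym_ideal(2)[OF n] unfolding sum by blast
qed

lemma keys_varx: "n \<ge> 1 \<Longrightarrow> Poly_Mapping.keys (varx n i) \<subseteq> monomials (xvars n)"
  by (auto simp: varx_def monomials_def xvars_def nat_less_iff)

lemma keys_vary: "n \<ge> 1 \<Longrightarrow> Poly_Mapping.keys (vary n i) \<subseteq> monomials (yvars n)"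
  by (auto simp: vary_def monomials_def yvars_def nat_less_iff)

text \<open>Both sides are the product of the \<open>n - 1\<close> variables \<open>x_j, ..., x_(j+n-2)\<close>.\<close>

lemma path_gen_shift:
  assumes "n \<ge> 3"
  shows "varx n (int j - 2) * path_gen n j = (varx n (int j) * path_gen n (j + 1) :: 'k::field mpoly)"
proof -
  let ?x = "\<lambda>t. varx n (int j + int t) :: 'k mpoly"
  have "varx n (int j - 2) = ?x (n - 2)"
  proof (rule varx_cong)
    have "int j + int (n - 2) = int j - 2 + int n" using assms by simp
    then show "(int j - 2) mod int n = (int j + int (n - 2)) mod int n" by (simp only: mod_add_self2)
  qed
  then have "varx n (int j - 2) * path_gen n j = (\<Prod>t<Suc (n - 2). ?x t)"
    by (simp add: path_gen_def)
  also have "\<dots> = ?x 0 * (\<Prod>t<n - 2. ?x (Suc t))"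
    by (rule prod.lessThan_Suc_shift)
  also have "\<dots> = varx n (int j) * path_gen n (j + 1)"
    by (simp add: path_gen_def algebra_simps)
  finally show ?thesis .
qed

lemma path_gen_cong: "n \<ge> 3 \<Longrightarrow> i mod n = j mod n \<Longrightarrow> path_gen n i = path_gen n j"
  by (simp add: path_gen_eq_single)

text \<open>The case \<open>j = 0\<close>, where \<open>f_0 = - g_1\<close>, starts the recursion for the \<open>g_k\<close>. The generators are
  indexed by \<open>1, ..., n\<close>, so that the residue \<open>0\<close> has to be represented by \<open>n\<close>.\<close>

lemma f_gen_in_sym_ideal:
  assumes n: "n \<ge> 3" and j: "j < n"
  shows "(f_gen n j :: 'k::field mpoly) \<in> sym_ideal n (path_gen n)"
proof -
  define i where "i = (if j = 0 then n else j)"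
  have "path_gen n i = (path_gen n j :: 'k mpoly)"
    by (rule path_gen_cong) (use n in \<open>simp_all add: i_def\<close>)
  then have "varx n (int j - 2) * vary n (int i) - varx n (int j) * vary n (int (j + 1))
      \<in> sym_ideal n (path_gen n :: nat \<Rightarrow> 'k mpoly)"
    using n j path_gen_shift[OF n, of j]
    by (intro binary_syzygy_in_sym_ideal keys_varx) (auto simp: i_def)
  moreover have "vary n (int i) = (vary n (int j) :: 'k mpoly)"
    by (rule vary_cong) (simp add: i_def)
  ultimately show ?thesis by (simp add: f_gen_def ac_simps)
qed

text \<open>The products of even and odd variables grow by \<open>y_(2k)\<close> and \<open>y_(2k+1)\<close>, so the terms with
  \<open>x_(n-2)\<close> cancel in \<open>g_(k+1) - y_(2k) g_k\<close>, and what is left is a multiple of \<open>f_(2k)\<close>.\<close>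

lemma g_gen_Suc:
  "g_gen n (Suc k) = (vary n (2 * int k) * g_gen n k -
    (\<Prod>i | i \<in> {0..<2 * k} \<and> odd i. vary n (int i)) * f_gen n (2 * k) :: 'k::field mpoly)"
proof -
  have less: "i < 2 * Suc k \<longleftrightarrow> i < 2 * k \<or> i = 2 * k \<or> i = 2 * k + 1" for i
    by auto
  have odd: "{i. i \<in> {0..<2 * Suc k} \<and> odd i} = insert (2 * k + 1) {i. i \<in> {0..<2 * k} \<and> odd i}"
    and even: "{i. i \<in> {0..<2 * Suc k} \<and> even i} = insert (2 * k) {i. i \<in> {0..<2 * k} \<and> even i}"
    by (simp_all only: atLeast0LessThan lessThan_iff less) auto
  show ?thesis
    unfolding g_gen_def f_gen_def odd even
    by (simp add: algebra_simps)
qed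

lemma keys_prod_monomials:
  assumes "\<And>i. i \<in> A \<Longrightarrow> Poly_Mapping.keys (p i :: 'k::field mpoly) \<subseteq> monomials V"
  shows "Poly_Mapping.keys (\<Prod>i\<in>A. p i) \<subseteq> monomials V"
  using assms
proof (induction A rule: infinite_finite_induct)
  case (insert a A)
  then show ?case using keys_mult_monomials[of "p a" V] by simp
qed (simp_all add: monomials_def)

text \<open>The recursion starts at \<open>g_0 = x_(-2) - x_(n-2) = 0\<close>.\<close>

lemma g_gen_in_sym_ideal:
  assumes n: "n \<ge> 3" and "2 * k \<le> n"
  shows "(g_gen n k :: 'k::field mpoly) \<in> sym_ideal n (path_gen n)"
  using assms(2)
proof (induction k)
  case 0
  have "varx n (2 * int 0 - 2) = (varx n (int n - 2) :: 'k mpoly)"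
    by (rule varx_cong) (simp add: mod_diff_left_eq flip: mod_add_self1[of "- 2" "int n"])
  then have "g_gen n 0 = (0 :: 'k mpoly)" by (simp add: g_gen_def)
  then show ?case using ideal_poly_ringD(4)[OF ideal_sym_ideal(1)[OF n]] by simp
next
  case (Suc k)
  let ?V = "xvars n \<union> yvars n"
  note D = ideal_poly_ringD[OF ideal_sym_ideal(1)[OF n, of "path_gen n :: nat \<Rightarrow> 'k mpoly"]]
  have y: "Poly_Mapping.keys (vary n i :: 'k mpoly) \<subseteq> monomials ?V" for i
    by (rule order_trans[OF keys_vary monomials_mono]) (use n in auto)
  let ?P = "\<Prod>i | i \<in> {0..<2 * k} \<and> odd i. vary n (int i) :: 'k mpoly"
  have "vary n (2 * int k) * g_gen n k \<in> sym_ideal n (path_gen n :: nat \<Rightarrow> 'k mpoly)"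
    using Suc by (intro D(3) y) simp
  moreover have "(- ?P) * f_gen n (2 * k) \<in> sym_ideal n (path_gen n)"
    using Suc.prems n by (intro D(3) f_gen_in_sym_ideal) (simp_all add: keys_prod_monomials y)
  ultimately have "vary n (2 * int k) * g_gen n k + (- ?P) * f_gen n (2 * k) \<in> sym_ideal n (path_gen n)"
    by (rule D(2))
  then show ?case by (simp add: g_gen_Suc)
qed


section \<open>The initial monomials of the generators\<close>

lemma lookup_sum_ymon:
  assumes "finite A"
  shows "Poly_Mapping.lookup (\<Sum>i\<in>A. ymon i) (YVar j) = (if j \<in> A then 1 else 0)"
    "Poly_Mapping.lookup (\<Sum>i\<in>A. ymon i) (XVar j) = 0"
  using assms by (simp_all add: lookup_sum lookup_single when_def)

lemma mon_degree_sum_ymon: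
  assumes "finite A"
  shows "mon_degree (\<Sum>i\<in>A. ymon i) = card A"
proof -
  have keys: "Poly_Mapping.keys (\<Sum>i\<in>A. ymon i) = YVar ` A"
  proof (rule Set.set_eqI)
    fix v show "v \<in> Poly_Mapping.keys (\<Sum>i\<in>A. ymon i) \<longleftrightarrow> v \<in> YVar ` A"
      using assms by (cases v) (auto simp: in_keys_iff lookup_sum_ymon)
  qed
  have "mon_degree (\<Sum>i\<in>A. ymon i) = (\<Sum>v\<in>YVar ` A. 1)"
    unfolding mon_degree_def keys
    by (rule sum.cong) (use assms in \<open>auto simp: lookup_sum_ymon\<close>)
  also have "\<dots> = card A" by (simp add: card_image inj_on_def)
  finally show ?thesis .
qed

text \<open>The position \<open>p\<close> counts from \<open>1\<close> to \<open>n\<close>, as in \<open>y_1 > ... > y_(n-1) > y_0\<close>. Of two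
  squarefree monomials of equal degree, the one that contains the last variable in which they
  differ is the smaller one.\<close>

lemma revlex_sum_ymonI:
  assumes n: "n \<ge> 1" and A: "A \<subseteq> {..<n}" and B: "B \<subseteq> {..<n}" and card: "card A = card B"
    and p: "p \<in> {1..n}" "p mod n \<in> A" "p mod n \<notin> B"
    and later: "\<And>q. p < q \<Longrightarrow> q \<le> n \<Longrightarrow> q mod n \<in> A \<longleftrightarrow> q mod n \<in> B"
  shows "revlex (map (\<lambda>i. YVar (i mod n)) [1..<n + 1]) (\<Sum>i\<in>A. ymon i) (\<Sum>i\<in>B. ymon i)"
proof -
  have fin: "finite A" "finite B" using A B finite_subset by blast+
  let ?vs = "map (\<lambda>i. YVar (i mod n)) [1..<n + 1]"
  have vs: "?vs ! i = YVar ((i + 1) mod n)" if "i < n" for i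
    using that by (simp add: nth_append del: upt_Suc)
  have "p - 1 < n" "(p - 1) + 1 = p" using p(1) by auto
  show ?thesis
    unfolding revlex_def
  proof (rule disjI2, intro conjI exI[of _ "p - 1"] allI impI)
    show "mon_degree (\<Sum>i\<in>A. ymon i) = mon_degree (\<Sum>i\<in>B. ymon i)"
      by (simp add: mon_degree_sum_ymon fin card)
    show "p - 1 < length ?vs" using \<open>p - 1 < n\<close> by simp
    show "Poly_Mapping.lookup (\<Sum>i\<in>B. ymon i) (?vs ! (p - 1)) < Poly_Mapping.lookup (\<Sum>i\<in>A. ymon i) (?vs ! (p - 1))"
      unfolding vs[OF \<open>p - 1 < n\<close>] \<open>(p - 1) + 1 = p\<close> using p by (simp add: lookup_sum_ymon fin)
    fix j assume j: "p - 1 < j \<and> j < length ?vs"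
    then have "j < n" "p < j + 1" "j + 1 \<le> n" using p(1) by auto
    then show "Poly_Mapping.lookup (\<Sum>i\<in>A. ymon i) (?vs ! j) = Poly_Mapping.lookup (\<Sum>i\<in>B. ymon i) (?vs ! j)"
      unfolding vs[OF \<open>j < n\<close>] using later[of "j + 1"] by (simp add: lookup_sum_ymon fin)
  qed
qed

text \<open>The exponents of the two terms of each \<open>f_j\<close> and each \<open>g_k\<close>, initial term first.\<close>

definition leading_pairs :: "nat \<Rightarrow> (monomial \<times> monomial) set"
  where "leading_pairs n =
    (\<lambda>j. (xmon ((j + n - 2) mod n) + ymon j, xmon j + ymon ((j + 1) mod n))) ` {1..n - 1} \<union>
    (\<lambda>k. (xmon (2 * k - 2) + (\<Sum>i | i < 2 * k \<and> odd i. ymon i),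
          xmon (n - 2) + (\<Sum>i | i < 2 * k \<and> even i. ymon i))) ` {1..n div 2}"

lemma f_gen_eq_binomial:
  assumes "n \<ge> 3" "j < n"
  shows "f_gen n j = Poly_Mapping.single (xmon ((j + n - 2) mod n) + ymon j) 1 -
    Poly_Mapping.single (xmon j + ymon ((j + 1) mod n)) (1::'k::field)"
proof -
  have "vary n (int j + 1) = (vary n (int (j + 1)) :: 'k mpoly)" by (simp add: add.commute)
  then show ?thesis
    using assms unfolding f_gen_def
    by (simp only: varx_minus_2 varx_of_nat vary_of_nat mult_single) simp
qed

lemma g_gen_eq_binomial:
  assumes "n \<ge> 3" "1 \<le> k" "k \<le> n div 2"
  shows "g_gen n k = Poly_Mapping.single (xmon (2 * k - 2) + (\<Sum>i | i < 2 * k \<and> odd i. ymon i)) 1 -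
    Poly_Mapping.single (xmon (n - 2) + (\<Sum>i | i < 2 * k \<and> even i. ymon i)) (1::'k::field)"
proof -
  have "2 * k \<le> n" using assms by auto
  have "2 * int k - 2 = int (2 * k - 2)" "int n - 2 = int (n - 2)" using assms by auto
  moreover have "varx n (int (2 * k - 2)) = (Poly_Mapping.single (xmon (2 * k - 2)) 1 :: 'k mpoly)"
    "varx n (int (n - 2)) = (Poly_Mapping.single (xmon (n - 2)) 1 :: 'k mpoly)"
    using \<open>2 * k \<le> n\<close> assms unfolding varx_of_nat by simp_all
  moreover have "(\<Prod>i | i \<in> {0..<2 * k} \<and> P i. vary n (int i)) =
      (Poly_Mapping.single (\<Sum>i | i < 2 * k \<and> P i. ymon i) 1 :: 'k mpoly)" for P
  proof -
    have "(\<Prod>i | i \<in> {0..<2 * k} \<and> P i. vary n (int i)) =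
        (\<Prod>i | i < 2 * k \<and> P i. Poly_Mapping.single (ymon i) 1 :: 'k mpoly)"
      using \<open>2 * k \<le> n\<close> by (intro prod.cong) (auto simp: vary_of_nat)
    then show ?thesis by (simp add: prod_single_one)
  qed
  ultimately show ?thesis
    unfolding g_gen_def by (simp only: mult_single mult_1)
qed

lemma binomials_of_leading_pairs:
  assumes "n \<ge> 3"
  shows "f_gen n ` {1..n - 1} \<union> g_gen n ` {1..n div 2} =
    (\<lambda>(u, v). Poly_Mapping.single u 1 - Poly_Mapping.single v (1::'k::field)) ` leading_pairs n"
proof -
  have "f_gen n ` {1..n - 1} = (\<lambda>j. Poly_Mapping.single (xmon ((j + n - 2) mod n) + ymon j) 1 -
      Poly_Mapping.single (xmon j + ymon ((j + 1) mod n)) (1::'k)) ` {1..n - 1}"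
    using assms by (intro image_cong f_gen_eq_binomial) auto
  moreover have "g_gen n ` {1..n div 2} =
      (\<lambda>k. Poly_Mapping.single (xmon (2 * k - 2) + (\<Sum>i | i < 2 * k \<and> odd i. ymon i)) 1 -
      Poly_Mapping.single (xmon (n - 2) + (\<Sum>i | i < 2 * k \<and> even i. ymon i)) (1::'k)) ` {1..n div 2}"
    using assms by (intro image_cong g_gen_eq_binomial) auto
  ultimately show ?thesis
    unfolding leading_pairs_def image_Un image_image by simp
qed

lemma card_odd_eq_card_even: "card {i. i < 2 * k \<and> odd i} = card {i. i < 2 * k \<and> even i}"
  for k :: nat
proof (rule bij_betw_same_card[symmetric])
  show "bij_betw Suc {i. i < 2 * k \<and> even i} {i. i < 2 * k \<and> odd i}"
    by (rule bij_betw_byWitness[where f' = "\<lambda>i. i - 1"]) (auto elim: oddE evenE)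
qed

lemma sum_ymon_in_monomials:
  assumes "A \<subseteq> {..<n}"
  shows "(\<Sum>i\<in>A. ymon i) \<in> monomials (yvars n)"
proof -
  have "finite A" using assms finite_subset by blast
  then show ?thesis
    using assms
  proof (induction A rule: finite_induct)
    case empty
    then show ?case by (simp add: monomials_def)
  next
    case (insert a A)
    then show ?case using monomials_add[of "ymon a" "yvars n"] by simp
  qed
qed

text \<open>All comparisons are decided by the \<open>y\<close>-parts. For \<open>f_j\<close> the later variable \<open>y_(j+1)\<close> makes its
  term the smaller one; for \<open>g_k\<close> it is \<open>y_0\<close>, the last variable, which divides only the term with
  the even indices.\<close>

lemma leading_pairs_decreasing:
  assumes n: "n \<ge> 3"
    and order: "is_product_order (yvars n) (xvars n)
      (revlex (map (\<lambda>i. YVar (i mod n)) [1..<n + 1])) lt2 lt"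
    and uv: "(u, v) \<in> leading_pairs n"
  shows "u \<in> monomials (xvars n \<union> yvars n) \<and> v \<in> monomials (xvars n \<union> yvars n) \<and> lt v u"
proof -
  have main: "xmon i + (\<Sum>i\<in>A. ymon i) \<in> monomials (xvars n \<union> yvars n) \<and>
      xmon i' + (\<Sum>i\<in>B. ymon i) \<in> monomials (xvars n \<union> yvars n) \<and>
      lt (xmon i' + (\<Sum>i\<in>B. ymon i)) (xmon i + (\<Sum>i\<in>A. ymon i))"
    if "i < n" "i' < n" "A \<subseteq> {..<n}" "B \<subseteq> {..<n}" "card A = card B"
      "p \<in> {1..n}" "p mod n \<notin> A" "p mod n \<in> B"
      "\<And>q. p < q \<Longrightarrow> q \<le> n \<Longrightarrow> q mod n \<in> A \<longleftrightarrow> q mod n \<in> B" for i i' A B p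
  proof -
    note sub = monomials_mono[of "xvars n" "xvars n \<union> yvars n"] monomials_mono[of "yvars n" "xvars n \<union> yvars n"]
    have x: "xmon i \<in> monomials (xvars n)" "xmon i' \<in> monomials (xvars n)" using that by auto
    have y: "(\<Sum>i\<in>A. ymon i) \<in> monomials (yvars n)" "(\<Sum>i\<in>B. ymon i) \<in> monomials (yvars n)"
      using that sum_ymon_in_monomials by auto
    have "revlex (map (\<lambda>i. YVar (i mod n)) [1..<n + 1]) (\<Sum>i\<in>B. ymon i) (\<Sum>i\<in>A. ymon i)"
      using that n by (intro revlex_sum_ymonI[of n B A p]) auto
    then have "lt (xmon i' + (\<Sum>i\<in>B. ymon i)) (xmon i + (\<Sum>i\<in>A. ymon i))"
      using order x y unfolding is_product_order_def by blast
    then show ?thesis using x y sub by (auto intro!: monomials_add)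
  qed
  from uv consider
    j where "j \<in> {1..n - 1}" "u = xmon ((j + n - 2) mod n) + ymon j" "v = xmon j + ymon ((j + 1) mod n)"
  | k where "k \<in> {1..n div 2}" "u = xmon (2 * k - 2) + (\<Sum>i | i < 2 * k \<and> odd i. ymon i)"
      "v = xmon (n - 2) + (\<Sum>i | i < 2 * k \<and> even i. ymon i)"
    unfolding leading_pairs_def by auto
  then show ?thesis
  proof cases
    case 1
    have j: "1 \<le> j" "j < n" using 1(1) n by auto
    have p: "(j + 1) mod n \<noteq> j"
      using add_mod_eq_self_iff[of j 1 n] j n by auto
    have later: "q mod n \<noteq> j \<and> q mod n \<noteq> (j + 1) mod n" if "j + 1 < q" "q \<le> n" for q
    proof (cases "q = n")
      case True
      then show ?thesis using that j by simp
    next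
      case False
      then show ?thesis using that by simp
    qed
    show ?thesis
      using main[of "(j + n - 2) mod n" j "{j}" "{(j + 1) mod n}" "j + 1"] j n p later 1(2,3) by auto
  next
    case 2
    then have k: "2 * k \<le> n" "1 \<le> k" by auto
    show ?thesis
      unfolding 2(2,3)
      by (rule main[of _ _ _ _ n]) (use k n card_odd_eq_card_even in auto)
  qed
qed

section \<open>Uniqueness of the standard monomial of a weight\<close>

lemma sum_lessThan_double:
  fixes f :: "nat \<Rightarrow> 'a::comm_monoid_add"
  shows "(\<Sum>j<2 * k. f j) = (\<Sum>i<k. f (2 * i) + f (2 * i + 1))"
  by (induction k) (simp_all add: algebra_simps)

text \<open>For \<open>i = j - 2\<close> modulo \<open>n\<close>, the two residues after \<open>i\<close> are \<open>j - 1\<close> and \<open>j\<close>; the assumption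
  \<open>j \<ge> 1\<close> keeps \<open>j - 1\<close> a residue.\<close>

lemma shift_mod_cases:
  fixes n j :: nat
  assumes "n \<ge> 3" "1 \<le> j" "j < n"
  shows "((j + n - 2) mod n + 1) mod n = j - 1" "((j + n - 2) mod n + 2) mod n = j"
proof -
  have "((j + n - 2) mod n + 1) mod n = (j + n - 2 + 1) mod n"
    by (rule mod_add_left_eq)
  also have "j + n - 2 + 1 = (j - 1) + n" using assms by simp
  also have "((j - 1) + n) mod n = j - 1" using assms by (subst mod_add_self2) simp
  finally show "((j + n - 2) mod n + 1) mod n = j - 1" .
  have "((j + n - 2) mod n + 2) mod n = (j + n - 2 + 2) mod n"
    by (rule mod_add_left_eq)
  also have "j + n - 2 + 2 = j + n" using assms by simp
  also have "(j + n) mod n = j" using assms by simp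
  finally show "((j + n - 2) mod n + 2) mod n = j" .
qed

lemma shift_mod_ge_2:
  fixes n j :: nat
  assumes "2 \<le> j" "j < n"
  shows "(j + n - 2) mod n = j - 2"
proof -
  have "j + n - 2 = (j - 2) + n" using assms by simp
  then show ?thesis using assms by (metis less_imp_diff_less mod_add_self2 mod_less)
qed

text \<open>The combinatorial heart. Here \<open>a, b\<close> and \<open>a', b'\<close> are the exponents of the \<open>x\<close>- and
  \<open>y\<close>-variables in two standard monomials; \<open>weight\<close> is the equality of the exponents of \<open>x_i\<close> in
  their weights after subtracting the common \<open>y\<close>-degree. The inequality \<open>le\<close> fixes which of the
  two is larger at \<open>y_0\<close>, and so the signs in the alternating sequence \<open>b - b'\<close>; for that choice
  the divisibility by an initial monomial of some \<open>g_k\<close> always concerns the second monomial.\<close>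

lemma standard_exponents_eq_of_le:
  fixes a b a' b' :: "nat \<Rightarrow> nat"
  assumes n: "n \<ge> 3"
    and weight: "\<And>i. i < n \<Longrightarrow>
      int (a i) - int (b ((i + 1) mod n)) - int (b ((i + 2) mod n)) =
      int (a' i) - int (b' ((i + 1) mod n)) - int (b' ((i + 2) mod n))"
    and degree: "(\<Sum>j<n. b j) = (\<Sum>j<n. b' j)"
    and f: "\<And>j. 1 \<le> j \<Longrightarrow> j < n \<Longrightarrow> a ((j + n - 2) mod n) = 0 \<or> b j = 0"
    and f': "\<And>j. 1 \<le> j \<Longrightarrow> j < n \<Longrightarrow> a' ((j + n - 2) mod n) = 0 \<or> b' j = 0"
    and g': "\<And>k. 1 \<le> k \<Longrightarrow> k \<le> n div 2 \<Longrightarrow> a' (2 * k - 2) = 0 \<or> (\<exists>i<k. b' (2 * i + 1) = 0)"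
    and x: "\<exists>i<n. a i + a' i > 0"
    and le: "b' 0 \<le> b 0"
  shows "\<forall>j<n. b j = b' j"
proof -
  define \<beta> where "\<beta> j = int (b j) - int (b' j)" for j
  \<comment> \<open>The signs are removed from the expected alternating pattern, so that \<open>\<gamma>\<close> should be
    nonnegative and nonincreasing.\<close>
  define \<gamma> where "\<gamma> j = (if even j then \<beta> j else - \<beta> j)" for j
  have diff: "int (a ((j + n - 2) mod n)) - int (a' ((j + n - 2) mod n)) = \<beta> (j - 1) + \<beta> j"
    if "1 \<le> j" "j < n" for j
    using weight[of "(j + n - 2) mod n"] shift_mod_cases[OF n that] n by (simp add: \<beta>_def)
  have pos: "\<beta> j \<le> 0" if "1 \<le> j" "j < n" "\<beta> (j - 1) + \<beta> j > 0" for j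
    using diff[OF that(1,2)] f[OF that(1,2)] that(3) by (auto simp: \<beta>_def)
  have neg: "\<beta> j \<ge> 0" if "1 \<le> j" "j < n" "\<beta> (j - 1) + \<beta> j < 0" for j
    using diff[OF that(1,2)] f'[OF that(1,2)] that(3) by (auto simp: \<beta>_def)
  have step: "0 \<le> \<gamma> j \<and> \<gamma> j \<le> \<gamma> (j - 1)" if "1 \<le> j" "j < n" "0 \<le> \<gamma> (j - 1)" for j
  proof (cases "even j")
    case True
    then have "\<gamma> j = \<beta> j" "\<gamma> (j - 1) = - \<beta> (j - 1)"
      using that(1) by (simp_all add: \<gamma>_def)
    then show ?thesis using pos[OF that(1,2)] neg[OF that(1,2)] that(3) by linarith
  next
    case False
    then have "\<gamma> j = - \<beta> j" "\<gamma> (j - 1) = \<beta> (j - 1)"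
      using that(1) by (simp_all add: \<gamma>_def)
    then show ?thesis using pos[OF that(1,2)] neg[OF that(1,2)] that(3) by linarith
  qed
  have nonneg: "0 \<le> \<gamma> j" if "j < n" for j
    using that
  proof (induction j)
    case 0
    then show ?case using le by (simp add: \<gamma>_def \<beta>_def)
  next
    case (Suc j)
    then show ?case using step[of "Suc j"] by simp
  qed
  have mono: "\<gamma> j \<le> \<gamma> (j - 1)" if "1 \<le> j" "j < n" for j
    using step[OF that] nonneg[of "j - 1"] that by simp
  have antimono: "\<gamma> j \<le> \<gamma> 0" if "j < n" for j
    using that
  proof (induction j)
    case (Suc j)
    then show ?case using mono[of "Suc j"] by simp
  qed simp
  \<comment> \<open>The sum of all \<open>\<beta>\<close> is \<open>0\<close> and splits into nonnegative parts, which therefore all vanish.\<close>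
  have pair_nonneg: "0 \<le> \<beta> (2 * i) + \<beta> (2 * i + 1)" if "i < n div 2" for i
  proof -
    have "2 * i + 1 < n" using that by linarith
    then show ?thesis using mono[of "2 * i + 1"] by (simp add: \<gamma>_def)
  qed
  have "(\<Sum>j<n. \<beta> j) = 0"
    using degree by (simp add: \<beta>_def sum_subtractf flip: of_nat_sum)
  moreover have "(\<Sum>j<n. \<beta> j) = (\<Sum>i<n div 2. \<beta> (2 * i) + \<beta> (2 * i + 1)) + (if odd n then \<gamma> (n - 1) else 0)"
  proof (cases "even n")
    case True
    then obtain k where "n = 2 * k" by (rule evenE)
    then show ?thesis by (simp add: sum_lessThan_double)
  next
    case False
    then obtain k where "n = 2 * k + 1" by (rule oddE)
    then show ?thesis by (simp add: sum_lessThan_double \<gamma>_def)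
  qed
  moreover have "0 \<le> (if odd n then \<gamma> (n - 1) else 0)"
    using nonneg[of "n - 1"] n by simp
  moreover have "0 \<le> (\<Sum>i<n div 2. \<beta> (2 * i) + \<beta> (2 * i + 1))"
    by (rule sum_nonneg) (use pair_nonneg in auto)
  ultimately have pair_sum: "(\<Sum>i<n div 2. \<beta> (2 * i) + \<beta> (2 * i + 1)) = 0"
    and last: "(if odd n then \<gamma> (n - 1) else 0) = 0"
    by linarith+
  have pair: "\<beta> (2 * i) + \<beta> (2 * i + 1) = 0" if "i < n div 2" for i
    using pair_sum that pair_nonneg by (subst (asm) sum_nonneg_eq_0_iff) auto
  have "\<gamma> 0 = 0"
  proof (rule ccontr)
    assume "\<gamma> 0 \<noteq> 0"
    \<comment> \<open>\<open>\<gamma>\<close> is constant below \<open>2 * (n div 2)\<close>: its first drop would be at an even index \<open>2k\<close>, and there the initial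
      monomial of \<open>g_k\<close> would divide the second monomial.\<close>
    define \<delta> where "\<delta> = \<gamma> 0"
    with \<open>\<gamma> 0 \<noteq> 0\<close> have c: "\<delta> > 0" using nonneg[of 0] n by simp
    have const: "2 * k \<le> n \<longrightarrow> (\<forall>j<2 * k. \<gamma> j = \<delta>)" for k
    proof (induction k)
      case (Suc k)
      show ?case
      proof
        assume kn: "2 * Suc k \<le> n"
        then have "2 * k \<le> n" by simp
        with Suc have IH: "\<gamma> j = \<delta>" if "j < 2 * k" for j using that by blast
        have even_step: "\<gamma> (2 * k) = \<delta>"
        proof (cases "k = 0")
          case False
          have b'pos: "b' (2 * i + 1) \<noteq> 0" if "i < k" for i
            using IH[of "2 * i + 1"] c that by (simp add: \<gamma>_def \<beta>_def)
          have "1 \<le> k" "k \<le> n div 2" using kn False by presburger+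
          from g'[OF this] have "a' (2 * k - 2) = 0" using b'pos by blast
          moreover have "(2 * k + n - 2) mod n = 2 * k - 2"
            using shift_mod_ge_2[of "2 * k" n] kn False by simp
          ultimately have "0 \<le> \<beta> (2 * k - 1) + \<beta> (2 * k)"
            using diff[of "2 * k"] kn False by simp
          then have "\<gamma> (2 * k - 1) \<le> \<gamma> (2 * k)"
            using False by (simp add: \<gamma>_def)
          then show ?thesis
            using IH[of "2 * k - 1"] mono[of "2 * k"] kn False by simp
        qed (simp add: \<delta>_def)
        have odd_step: "\<gamma> (2 * k + 1) = \<delta>"
        proof -
          have "k < n div 2" using kn by presburger
          from pair[OF this] have "\<gamma> (2 * k + 1) = \<gamma> (2 * k)" by (simp add: \<gamma>_def)
          then show ?thesis using even_step by (rule trans)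
        qed
        show "\<forall>j<2 * Suc k. \<gamma> j = \<delta>"
        proof (intro allI impI)
          fix j assume "j < 2 * Suc k"
          then have "j < 2 * k \<or> j = 2 * k \<or> j = 2 * k + 1" by arith
          then consider "j < 2 * k" | "j = 2 * k" | "j = 2 * k + 1" by blast
          then show "\<gamma> j = \<delta>"
            by cases (rule IH, assumption, use even_step odd_step in simp_all)
        qed
      qed
    qed simp
    have b'pos: "b' (2 * i + 1) \<noteq> 0" if "i < n div 2" for i
    proof -
      have "2 * i + 1 < 2 * (n div 2)" using that by simp
      then have "\<gamma> (2 * i + 1) = \<delta>" using const[of "n div 2"] by simp
      then show ?thesis using c by (simp add: \<gamma>_def \<beta>_def)
    qed
    \<comment> \<open>The last \<open>g_k\<close> now forbids the variable \<open>x_(2k-2)\<close> in the second monomial.\<close>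
    have a'0: "a' (2 * (n div 2) - 2) = 0"
    proof -
      have "1 \<le> n div 2" using n by presburger
      from g'[OF this order.refl] show ?thesis using b'pos by blast
    qed
    show False
    proof (cases "even n")
      case False
      then obtain k where nk: "n = 2 * k + 1" by (rule oddE)
      have "\<gamma> (2 * k) = 0" using last nk by simp
      moreover have "\<gamma> (2 * k - 1) = \<delta>" using const[of k] nk n by simp
      ultimately have "\<beta> (2 * k - 1) + \<beta> (2 * k) < 0"
        using c nk n by (simp add: \<gamma>_def split: if_splits)
      moreover have "(2 * k + n - 2) mod n = 2 * k - 2"
        using shift_mod_ge_2[of "2 * k" n] nk n by simp
      ultimately have "a' (2 * k - 2) > 0"
        using diff[of "2 * k"] nk n by simp
      then show False using a'0 nk by simp
    next
      case True
      then have "2 * (n div 2) = n" by simp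
      from const[of "n div 2", unfolded this] have all: "\<gamma> j = \<delta>" if "j < n" for j
        using that by blast
      \<comment> \<open>Here \<open>\<beta>\<close> alternates between two opposite values around the whole cycle, so the two monomials
        have the same \<open>x\<close>-part.\<close>
      obtain i where i: "i < n" "a i + a' i > 0" using x by (elim exE conjE)
      have eq: "a i = a' i"
      proof -
        have par: "\<beta> ((i + 1) mod n) + \<beta> ((i + 2) mod n) = 0"
        proof -
          have "even ((i + 1) mod n) \<longleftrightarrow> even (i + 1)" "even ((i + 2) mod n) \<longleftrightarrow> even (i + 2)"
            by (rule dvd_mod_iff[OF True])+
          moreover have "\<gamma> ((i + 1) mod n) = \<delta>" "\<gamma> ((i + 2) mod n) = \<delta>"
            using n by (auto intro!: all)
          ultimately show ?thesis
            by (cases "even i") (simp_all add: \<gamma>_def)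
        qed
        then show ?thesis using weight[OF i(1)] by (simp add: \<beta>_def)
      qed
      show False
      proof (cases "i = n - 2")
        case True
        then have "2 * (n div 2) - 2 = i" using \<open>even n\<close> by simp
        then show False using a'0 eq i(2) by simp
      next
        case False
        define j where "j = (i + 2) mod n"
        have "j \<noteq> 0"
        proof (cases "i = n - 1")
          case True
          then have "i + 2 = 1 + n" using n by simp
          then have "j = 1" using n unfolding j_def by (simp only: mod_add_self2) simp
          then show ?thesis by simp
        next
          case False
          then show ?thesis using \<open>i \<noteq> n - 2\<close> i n by (simp add: j_def)
        qed
        then have j: "1 \<le> j" "j < n" using n by (simp_all add: j_def)
        have "(j + n - 2) mod n = (j + (n - 2)) mod n" using n by simp
        also have "\<dots> = (i + 2 + (n - 2)) mod n"
          unfolding j_def by (rule mod_add_left_eq)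
        also have "i + 2 + (n - 2) = i + n" using n by simp
        also have "(i + n) mod n = i" using i by simp
        finally have ji: "(j + n - 2) mod n = i" .
        then have "b j = 0" "b' j = 0" using f[OF j] f'[OF j] eq i(2) by auto
        then have "\<gamma> j = 0" by (simp add: \<gamma>_def \<beta>_def)
        then show False using all[OF j(2)] c by simp
      qed
    qed
  qed
  then have zero: "\<gamma> j = 0" if "j < n" for j
    using nonneg[OF that] antimono[OF that] by simp
  have "\<beta> j = 0" if "j < n" for j
    using zero[OF that] by (simp add: \<gamma>_def split: if_splits)
  then show ?thesis by (simp add: \<beta>_def)
qed

lemma not_divisible_exponents:
  assumes std: "standard (fst ` leading_pairs n) m"
  shows "1 \<le> j \<Longrightarrow> j < n \<Longrightarrow> Poly_Mapping.lookup m (XVar ((j + n - 2) mod n)) = 0 \<or> Poly_Mapping.lookup m (YVar j) = 0"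
    and "1 \<le> k \<Longrightarrow> k \<le> n div 2 \<Longrightarrow> Poly_Mapping.lookup m (XVar (2 * k - 2)) = 0 \<or>
      (\<exists>i<k. Poly_Mapping.lookup m (YVar (2 * i + 1)) = 0)"
proof -
  have dvd: "m = u + (m - u)"
    if "\<And>i. Poly_Mapping.lookup u (XVar i) \<le> Poly_Mapping.lookup m (XVar i)"
      "\<And>i. Poly_Mapping.lookup u (YVar i) \<le> Poly_Mapping.lookup m (YVar i)" for u
    by (rule poly_mapping_var_eqI) (simp_all add: lookup_add lookup_minus that)
  show "Poly_Mapping.lookup m (XVar ((j + n - 2) mod n)) = 0 \<or> Poly_Mapping.lookup m (YVar j) = 0"
    if "1 \<le> j" "j < n"
  proof (rule ccontr)
    assume pos: "\<not> ?thesis"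
    have "(xmon ((j + n - 2) mod n) + ymon j, xmon j + ymon ((j + 1) mod n)) \<in> leading_pairs n"
      using that unfolding leading_pairs_def by auto
    moreover have "m = xmon ((j + n - 2) mod n) + ymon j + (m - (xmon ((j + n - 2) mod n) + ymon j))"
      using pos by (intro dvd) (auto simp: lookup_add)
    ultimately show False using std unfolding standard_def by force
  qed
  show "Poly_Mapping.lookup m (XVar (2 * k - 2)) = 0 \<or>
      (\<exists>i<k. Poly_Mapping.lookup m (YVar (2 * i + 1)) = 0)" if k: "1 \<le> k" "k \<le> n div 2"
  proof (rule ccontr)
    assume pos: "\<not> ?thesis"
    let ?O = "{i. i < 2 * k \<and> odd i}"
    let ?u = "xmon (2 * k - 2) + (\<Sum>i\<in>?O. ymon i)"
    have "(?u, xmon (n - 2) + (\<Sum>i | i < 2 * k \<and> even i. ymon i)) \<in> leading_pairs n"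
      using k unfolding leading_pairs_def by auto
    moreover have "m = ?u + (m - ?u)"
    proof (rule dvd)
      fix i
      show "Poly_Mapping.lookup ?u (XVar i) \<le> Poly_Mapping.lookup m (XVar i)"
        using pos by (auto simp: lookup_add lookup_sum_ymon)
      show "Poly_Mapping.lookup ?u (YVar i) \<le> Poly_Mapping.lookup m (YVar i)"
      proof (cases "i \<in> ?O")
        case True
        then obtain t where "i = 2 * t + 1" by (auto elim: oddE)
        then show ?thesis using pos True by (auto simp: lookup_add lookup_sum_ymon Suc_le_eq)
      next
        case False
        then have "Poly_Mapping.lookup ?u (YVar i) = 0"
          by (subst lookup_add) (subst lookup_sum_ymon, simp_all)
        then show ?thesis by simp
      qed
    qed
    ultimately show False using std unfolding standard_def by force
  qed
qed

text \<open>The degrees in \<open>t\<close> agree, so equality of the \<open>x_i\<close>-exponents of the weights turns into the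
  local relation between \<open>a_i\<close>, \<open>b_(i+1)\<close> and \<open>b_(i+2)\<close>. The variable in \<open>x\<close> is essential: for even
  \<open>n\<close> the products of all \<open>y_j\<close> with odd \<open>j\<close> and of all \<open>y_j\<close> with even \<open>j\<close> are distinct
  standard monomials of the same weight.\<close>

lemma standard_monomial_unique:
  assumes n: "n \<ge> 3"
    and V: "m \<in> monomials (xvars n \<union> yvars n)" "m' \<in> monomials (xvars n \<union> yvars n)"
    and weight: "weight n m' = weight n m"
    and x: "\<exists>i<n. Poly_Mapping.lookup m (XVar i) \<noteq> 0"
    and std: "standard (fst ` leading_pairs n) m" "standard (fst ` leading_pairs n) m'"
  shows "m' = m"
proof -
  define a b a' b' where "a i = Poly_Mapping.lookup m (XVar i)" and "b i = Poly_Mapping.lookup m (YVar i)"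
    and "a' i = Poly_Mapping.lookup m' (XVar i)" and "b' i = Poly_Mapping.lookup m' (YVar i)" for i
  note defs = a_def b_def a'_def b'_def
  have degree: "(\<Sum>j<n. b j) = (\<Sum>j<n. b' j)"
    using arg_cong[OF weight, of "\<lambda>m. Poly_Mapping.lookup m (YVar 0)"] by (simp add: lookup_weight defs)
  have split: "(\<Sum>j<n. c j) = (\<Sum>j\<in>{..<n} - {(i + 1) mod n, (i + 2) mod n}. c j) +
      c ((i + 1) mod n) + c ((i + 2) mod n)" for c :: "nat \<Rightarrow> nat" and i
  proof -
    have "(i + 1) mod n \<noteq> (i + 2) mod n"
      using add_mod_eq_self_iff[of "i + 1" 1 n] n by auto
    moreover have "{(i + 1) mod n, (i + 2) mod n} \<subseteq> {..<n}" using n by auto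
    ultimately show ?thesis
      using sum.subset_diff[of "{(i + 1) mod n, (i + 2) mod n}" "{..<n}" c] by simp
  qed
  have w: "int (a i) - int (b ((i + 1) mod n)) - int (b ((i + 2) mod n)) =
      int (a' i) - int (b' ((i + 1) mod n)) - int (b' ((i + 2) mod n))" if "i < n" for i
  proof -
    have "a i + (\<Sum>j\<in>{..<n} - {(i + 1) mod n, (i + 2) mod n}. b j) =
        a' i + (\<Sum>j\<in>{..<n} - {(i + 1) mod n, (i + 2) mod n}. b' j)"
      using arg_cong[OF weight, of "\<lambda>m. Poly_Mapping.lookup m (XVar i)"] that
      by (simp add: lookup_weight defs)
    then show ?thesis using split[of b i] split[of b' i] degree by linarith
  qed
  have f: "a ((j + n - 2) mod n) = 0 \<or> b j = 0" "a' ((j + n - 2) mod n) = 0 \<or> b' j = 0"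
    if "1 \<le> j" "j < n" for j
    using not_divisible_exponents(1)[OF std(1) that] not_divisible_exponents(1)[OF std(2) that]
    unfolding defs by blast+
  have g: "a (2 * k - 2) = 0 \<or> (\<exists>i<k. b (2 * i + 1) = 0)" "a' (2 * k - 2) = 0 \<or> (\<exists>i<k. b' (2 * i + 1) = 0)"
    if "1 \<le> k" "k \<le> n div 2" for k
    using not_divisible_exponents(2)[OF std(1) that] not_divisible_exponents(2)[OF std(2) that]
    unfolding defs by blast+
  have x1: "\<exists>i<n. a i + a' i > 0" and x2: "\<exists>i<n. a' i + a i > 0"
    using x by (auto simp: defs)
  have b: "\<forall>j<n. b j = b' j"
  proof (cases "b' 0 \<le> b 0")
    case True
    then show ?thesis
      using standard_exponents_eq_of_le[of n a b a' b', OF n w degree f g(2) x1] by blast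
  next
    case False
    then have "b 0 \<le> b' 0" by simp
    then have "\<forall>j<n. b' j = b j"
      using standard_exponents_eq_of_le[of n a' b' a b, OF n w[symmetric] degree[symmetric] f(2,1) g(1) x2] by blast
    then show ?thesis by simp
  qed
  have outside: "Poly_Mapping.lookup k (XVar i) = 0" "Poly_Mapping.lookup k (YVar i) = 0"
    if "k \<in> monomials (xvars n \<union> yvars n)" "\<not> i < n" for k i
    using that by (force simp: monomials_def xvars_def yvars_def in_keys_iff)+
  show ?thesis
  proof (rule poly_mapping_var_eqI)
    fix i
    show "Poly_Mapping.lookup m' (YVar i) = Poly_Mapping.lookup m (YVar i)"
      using b outside V by (cases "i < n") (auto simp: defs)
    show "Poly_Mapping.lookup m' (XVar i) = Poly_Mapping.lookup m (XVar i)"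
    proof (cases "i < n")
      case True
      then have "b ((i + 1) mod n) = b' ((i + 1) mod n)" "b ((i + 2) mod n) = b' ((i + 2) mod n)"
        using b by simp_all
      then have "a i = a' i" using w[OF True] by simp
      then show ?thesis by (simp add: defs)
    qed (simp add: outside V)
  qed
qed

section \<open>The Groebner basis\<close>

theorem theorem4p2:
  fixes n :: nat
    and lt lt2 :: "monomial \<Rightarrow> monomial \<Rightarrow> bool"
  assumes "n \<ge> 3"
    and "monomial_order (xvars n \<union> yvars n) lt"
    and "monomial_order (xvars n) lt2"
    and "is_product_order (yvars n) (xvars n)
           (revlex (map (\<lambda>i. YVar (i mod n)) [1..<n + 1])) lt2 lt"
  shows "is_groebner_basis (xvars n \<union> yvars n) lt
           (f_gen n ` {1..n - 1} \<union> g_gen n ` {1..n div 2})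
           (sym_ideal n (path_gen n) :: 'k::field mpoly set)"
proof -
  let ?I = "sym_ideal n (path_gen n) :: 'k mpoly set"
  note I = ideal_sym_ideal(1)[OF assms(1), of "path_gen n :: nat \<Rightarrow> 'k mpoly"]
  have members: "f_gen n ` {1..n - 1} \<union> g_gen n ` {1..n div 2} \<subseteq> ?I"
  proof (intro Un_least image_subsetI)
    show "f_gen n j \<in> ?I" if "j \<in> {1..n - 1}" for j
      using that assms(1) by (intro f_gen_in_sym_ideal) auto
    show "g_gen n k \<in> ?I" if "k \<in> {1..n div 2}" for k
      using that by (intro g_gen_in_sym_ideal assms(1)) auto
  qed
  show ?thesis
  proof (rule binomial_groebner_basis[where w = "weight n" and B = "leading_pairs n"])
    show "finite (leading_pairs n)" by (simp add: leading_pairs_def)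
    show "m' = m"
      if "p \<in> ?I" "m \<in> Poly_Mapping.keys p" "m' \<in> monomials (xvars n \<union> yvars n)" "weight n m' = weight n m"
        "standard (fst ` leading_pairs n) m" "standard (fst ` leading_pairs n) m'" for p m m'
    proof (rule standard_monomial_unique[OF assms(1)])
      show "m \<in> monomials (xvars n \<union> yvars n)" using ideal_poly_ringD(1)[OF I that(1)] that(2) by blast
      show "\<exists>i<n. Poly_Mapping.lookup m (XVar i) \<noteq> 0"
        using sym_ideal_subset_kernel(2)[OF assms(1) that(1,2)] .
    qed (use that in simp_all)
    show "u \<in> monomials (xvars n \<union> yvars n) \<and> v \<in> monomials (xvars n \<union> yvars n) \<and> lt v u"
      if "(u, v) \<in> leading_pairs n" for u v
      by (rule leading_pairs_decreasing[OF assms(1,4) that])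
  qed (rule assms(2) binomials_of_leading_pairs[OF assms(1)] I members weight_add
      sym_ideal_subset_kernel(1)[OF assms(1)] finite_weight_fibre, assumption?)+
qed

end
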